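(* Let $(\mathsf{X},\varrho)$ be a complete separable metric space with Borel $\sigma$-algebra $\mathcal{B}$, let $\psi:\mathsf{X}\times\mathsf{X}\to[0,\infty)$ be lower semi-continuous, and let $P$ be a Markov transition kernel on $(\mathsf{X},\mathcal{B})$. Assume the following. (i) There exist a measurable function $V:\mathsf{X}\to[0,\infty)$ and $a\in[0,\infty)$ such that $\psi(x,y)\le a[V(x)+V(y)+1]$ for all $(x,y)\in\mathsf{X}\times\mathsf{X}$, and $PV(x)<\infty$ for each $x\in\mathsf{X}$. (ii) There exists a measurable function $\Gamma:\mathsf{X}\times\mathsf{X}\to[0,\infty)$ such that $W_\psi(\delta_xP,\delta_yP)\le\Gamma(x,y)\,\psi(x,y)$ for each $(x,y)\in\mathsf{X}\times\mathsf{X}$. Let $\Lambda:\mathsf{X}\times\mathsf{X}\to[0,\infty)$ be such that $$\Lambda(x,y)\ge\frac{PV(x)+PV(y)+1}{V(x)+V(y)+1}\qquad\text{for all }(x,y)\in\mathsf{X}\times\mathsf{X}.$$ (iii) Assume further that there exists $r\in(0,1)$ such that $$\rho_r:=\sup_{(x,y)\in\mathsf{X}\times\mathsf{X}}\Gamma(x,y)^r\Lambda(x,y)^{1-r}<1.$$ Then, for such $r$ and for all $\mu,\nu\in\mathcal{P}(\mathsf{X})$, $$W_\psi(\mu P^n,\nu P^n)\le a(\mu V+\nu V+1)\,\rho_r^n,\qquad n\in\mathbb{Z}_+.$$ In particular, if $P$ admits a stationary distribution $\varpi$, then for every $\mu\in\mathcal{P}(\mathsf{X})$, $$W_\psi(\mu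 P^n,\varpi)\le a(\mu V+\varpi V+1)\,\rho_r^n,\qquad n\in\mathbb{Z}_+.$$
   Context: $\mathbb{Z}_+=\{0,1,2,\dots\}$. $\mathcal{P}(\mathsf{X})$ is the set of probability measures on $(\mathsf{X},\mathcal{B})$ and $\delta_x$ is the point mass at $x$. For $\mu,\nu\in\mathcal{P}(\mathsf{X})$, $\mathcal{C}(\mu,\nu)$ is the set of couplings, i.e. probability measures on $\mathsf{X}\times\mathsf{X}$ with first marginal $\mu$ and second marginal $\nu$. The Wasserstein divergence induced by $\psi$ is $W_\psi(\mu,\nu)=\inf_{\upsilon\in\mathcal{C}(\mu,\nu)}\int_{\mathsf{X}\times\mathsf{X}}\psi(x,y)\,\upsilon(dx,dy)\in[0,\infty]$. $P^n$ denotes the $n$-step kernel ($P^0$ is the identity kernel). For measurable $f$, $\mu f=\int f\,d\mu$, $\mu P^n(\cdot)=\int P^n(x,\cdot)\,\mu(dx)$, and $P^nf(x)=\int f(y)\,P^n(x,dy)$. A stationary distribution is $\varpi\in\mathcal{P}(\mathsf{X})$ with $\varpi P=\varpi$. The quantities $\mu V,\nu V,\varpi V$ may be $+\infty$ (with the usual convention $0\cdot\infty=0$). *)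

theory Defs
  imports "HOL-Probability.Probability"
begin

text \<open>
  The state space is a type of class \<open>polish_space\<close>, i.e. a metric space that is complete and
  second countable (for metric spaces the same as separable), with \<open>borel\<close> as its
  \<open>\<sigma>\<close>-algebra; \<open>\<P>(X)\<close> is \<open>space (prob_algebra borel)\<close>. A Markov transition kernel is a
  measurable map \<open>P \<in> borel \<rightarrow>\<^sub>M prob_algebra borel\<close>; for such \<open>P\<close> the measure \<open>\<mu>P\<close> is the
  Giry bind \<open>\<mu> \<bind> P\<close>, and \<open>\<delta>\<^sub>x\<close> is \<open>return borel x\<close>.
\<close>

definition lower_semicontinuous :: "('a::topological_space \<Rightarrow> real) \<Rightarrow> bool" where
  "lower_semicontinuous f \<longleftrightarrow> (\<forall>x. \<forall>c < f x. \<forall>\<^sub>F y in nhds x. c < f y)"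

definition couplings :: "'a::topological_space measure \<Rightarrow> 'a measure \<Rightarrow> ('a \<times> 'a) measure set" where
  "couplings \<mu> \<nu> = {\<upsilon> \<in> space (prob_algebra (borel \<Otimes>\<^sub>M borel)).
     distr \<upsilon> borel fst = \<mu> \<and> distr \<upsilon> borel snd = \<nu>}"

text \<open>The cost is a real function that is assumed nonnegative wherever this is used.\<close>

definition wasserstein ::
  "('a::topological_space \<times> 'a \<Rightarrow> real) \<Rightarrow> 'a measure \<Rightarrow> 'a measure \<Rightarrow> ennreal" where
  "wasserstein \<psi> \<mu> \<nu> = (INF \<upsilon>\<in>couplings \<mu> \<nu>. \<integral>\<^sup>+ z. ennreal (\<psi> z) \<partial>\<upsilon>)"

primrec kernel_power ::
  "('a::topological_space \<Rightarrow> 'a measure) \<Rightarrow> nat \<Rightarrow> 'a \<Rightarrow> 'a measure" where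
  "kernel_power P 0 = (\<lambda>x. return borel x)"
| "kernel_power P (Suc n) = (\<lambda>x. kernel_power P n x \<bind> P)"

definition stationary :: "('a::topological_space \<Rightarrow> 'a measure) \<Rightarrow> 'a measure \<Rightarrow> bool" where
  "stationary P \<pi> \<longleftrightarrow> \<pi> \<in> space (prob_algebra borel) \<and> \<pi> \<bind> P = \<pi>"

text \<open>The supremum is taken in \<open>[0,\<infinity>]\<close>, so that it is meaningful without a boundedness assumption.\<close>

definition contraction_rate ::
  "('a \<times> 'a \<Rightarrow> real) \<Rightarrow> ('a \<times> 'a \<Rightarrow> real) \<Rightarrow> real \<Rightarrow> ennreal" where
  "contraction_rate \<Gamma> \<Lambda> r = (SUP z. ennreal (\<Gamma> z powr r * \<Lambda> z powr (1 - r)))"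

end

theory Submission
  imports Defs
begin

text \<open>
  Let \<open>h(x, y) = \<psi>(x, y)\<^sup>r (a (V x + V y + 1))\<^sup>1\<^sup>-\<^sup>r\<close>, so that \<open>\<psi> \<le> h \<le> a (V x + V y + 1)\<close>. By Hoelder's
  inequality \<open>W\<^sub>h(\<delta>\<^sub>xP, \<delta>\<^sub>yP) \<le> \<rho>\<^sub>r h(x, y)\<close>. If this bound can be integrated against any coupling
  of \<open>\<mu>\<close> and \<open>\<nu>\<close>, then \<open>W\<^sub>h(\<mu>P, \<nu>P) \<le> \<rho>\<^sub>r W\<^sub>h(\<mu>, \<nu>)\<close>, and iterating gives the theorem.

  The integration is done without a measurable selection of optimal couplings. Refining finite Borel
  partitions approximate \<open>h\<close> from below by costs that are constant on cells; \<open>V\<close> need not be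
  semicontinuous, because its superlevel sets are taken into the partitions. For such a cost a coupling
  matters only through a finite matrix, and after rounding the matrix entries there are finitely many
  candidates, among which a measurable choice is trivial. The resulting couplings of \<open>\<mu>P\<close> and \<open>\<nu>P\<close>
  subconverge because coding a point by the cells containing it turns them into measures on the
  Cantor space, which is compact.
\<close>

section \<open>Compactness of the probability measures on the Cantor space\<close>

text \<open>Neither \<open>\<Gamma>\<close> nor \<open>\<Lambda>\<close> need be below 1; only
  \<Gamma>^r \<Lambda>^(1-r) is, uniformly. So the iterated cost should be one that a single step
  multiplies by exactly this mean. Write u(x, y) = a (V x + V y + 1). A nearly optimal coupling
  multiplies \<psi> by about \<Gamma> at most, and every coupling multiplies u by at most \<Lambda>,
  because the integral of u sees only the marginals. Hence one coupling serves both factors in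
  Hoelder's inequality, and h = \<psi>^r u^(1-r) is the right cost. The obstacle is gluing: joining
  couplings of P x and P y into one of \<mu>P and \<nu>P requires a choice that is measurable in (x,
  y), and selection theorems for optimal couplings ask for a lower semicontinuous cost, which h is
  not when V is merely measurable. Costs constant on cells are functions of finitely many bits of
  the code, hence continuous on the Cantor space, so weak limits respect them. A limit there could
  still charge bit sequences that code no point; this is excluded because all the couplings share
  the same two marginals.\<close>

abbreviation bits :: "(nat \<Rightarrow> bool) measure" where
  "bits \<equiv> PiM UNIV (\<lambda>_. count_space UNIV)"

text \<open>These are the locally constant functions on the Cantor space. They are the test
  functions for weak convergence below.\<close>

definition depends_on_first :: "nat \<Rightarrow> ((nat \<Rightarrow> bool) \<Rightarrow> 'b) \<Rightarrow> bool" where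
  "depends_on_first k F \<longleftrightarrow> (\<forall>b b'. (\<forall>i<k. b i = b' i) \<longrightarrow> F b = F b')"

lemma measurable_bits_prefix [measurable]:
  "(\<lambda>b. map b [0..<k]) \<in> bits \<rightarrow>\<^sub>M count_space UNIV"
proof (induction k)
  case (Suc k)
  note [measurable] = Suc
  have "(\<lambda>b. (\<lambda>(u, v). u @ [v]) (map b [0..<k], b k)) \<in> bits \<rightarrow>\<^sub>M count_space UNIV"
    by measurable
  then show ?case by simp
qed simp

text \<open>Such an \<open>F\<close> factors through the bit lists of length \<open>k\<close>, a
  discrete space on which every function is measurable. The witness \<open>G\<close> pads a list
  with \<open>False\<close>.\<close>

lemma depends_on_first_measurable:
  fixes F :: "(nat \<Rightarrow> bool) \<Rightarrow> 'b"
  assumes "depends_on_first k F" and sp: "range F \<subseteq> space N"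
  shows "F \<in> bits \<rightarrow>\<^sub>M N"
proof -
  define G where "G l = F (\<lambda>i. i < k \<and> l ! i)" for l :: "bool list"
  have "F b = G (map b [0..<k])" for b
    using assms(1) unfolding depends_on_first_def G_def by auto
  then have eq: "F = (\<lambda>b. G (map b [0..<k]))" by auto
  have "G \<in> count_space UNIV \<rightarrow>\<^sub>M N" using sp by (auto simp: G_def)
  then show ?thesis unfolding eq by (rule measurable_compose[OF measurable_bits_prefix])
qed

text \<open>
  The ternary expansion carries the question over to the real line, where Helly's selection theorem and
  Skorohod's representation are available. The gap \<open>(1/3, 2/3)\<close> makes the digits continuous on the
  Cantor set.
\<close>

definition ternary :: "(nat \<Rightarrow> bool) \<Rightarrow> real" where
  "ternary b = (\<Sum>i. 2 * of_bool (b i) / 3 ^ Suc i)"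

lemma ternary_sums_one: "(\<lambda>i. 2 * (1 / 3 ^ Suc i) :: real) sums 1"
  using sums_mult[OF geometric_sums[of "1/3::real"], of "2/3"] by (simp add: field_simps)

lemma ternary_summable: "summable (\<lambda>i. 2 * of_bool (b i) / 3 ^ Suc i :: real)"
  by (rule summable_comparison_test'[OF sums_summable[OF ternary_sums_one], of 0]) (auto simp: of_bool_def)

lemma ternary_nonneg: "0 \<le> ternary b"
  unfolding ternary_def by (intro suminf_nonneg ternary_summable) simp

lemma ternary_le_1: "ternary b \<le> 1"
proof -
  have "ternary b \<le> (\<Sum>i. 2 * (1 / 3 ^ Suc i))"
    unfolding ternary_def
    by (intro suminf_le ternary_summable sums_summable[OF ternary_sums_one]) (auto simp: of_bool_def)
  then show ?thesis using sums_unique[OF ternary_sums_one] by simp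
qed

text \<open>Self-similarity of the Cantor set: the first bit selects the left or the right third,
  and the remaining bits give the position inside it.\<close>

lemma ternary_unfold: "ternary b = (2 * of_bool (b 0) + ternary (\<lambda>i. b (Suc i))) / 3"
proof -
  have "ternary b = 2 * of_bool (b 0) / 3 + (\<Sum>i. 2 * of_bool (b (Suc i)) / 3 ^ Suc (Suc i))"
    unfolding ternary_def using suminf_split_head[OF ternary_summable[of b]] by simp
  also have "(\<Sum>i. 2 * of_bool (b (Suc i)) / 3 ^ Suc (Suc i) :: real) = ternary (\<lambda>i. b (Suc i)) / 3"
    unfolding ternary_def
    by (subst suminf_divide[OF ternary_summable, symmetric]) (simp add: field_simps)
  finally show ?thesis by simp
qed

lemma ternary_half_iff: "1 / 2 < ternary b \<longleftrightarrow> b 0"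
  using ternary_unfold[of b] ternary_nonneg[of "\<lambda>i. b (Suc i)"] ternary_le_1[of "\<lambda>i. b (Suc i)"]
  by (cases "b 0") auto

text \<open>The constant 1/6 is half the width of the removed middle third.\<close>

lemma ternary_gap: "\<bar>ternary b - 1 / 2\<bar> \<ge> 1 / 6"
  using ternary_unfold[of b] ternary_nonneg[of "\<lambda>i. b (Suc i)"] ternary_le_1[of "\<lambda>i. b (Suc i)"]
  by (cases "b 0") auto

lemma ternary_shift: "3 * ternary b - 2 * of_bool (1 / 2 < ternary b) = ternary (\<lambda>i. b (Suc i))"
  unfolding ternary_half_iff using ternary_unfold[of b] by simp

lemma measurable_ternary [measurable]: "ternary \<in> bits \<rightarrow>\<^sub>M borel"
  unfolding ternary_def[abs_def] by measurable

text \<open>The threshold 1/2 lies in the middle of the gap, and the recursion follows the expanding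
  map whose inverse branches are in \<open>ternary_unfold\<close>. The function is total on the
  reals, with junk digits off the Cantor set, because it will be applied to real random
  variables.\<close>

primrec digit :: "nat \<Rightarrow> real \<Rightarrow> bool" where
  "digit 0 t = (1 / 2 < t)"
| "digit (Suc i) t = digit i (3 * t - 2 * of_bool (1 / 2 < t))"

lemma digit_ternary: "digit i (ternary b) = b i"
proof (induction i arbitrary: b)
  case (Suc i)
  show ?case using Suc by (simp only: digit.simps ternary_shift)
qed (simp only: digit.simps ternary_half_iff)

lemma measurable_digit [measurable]: "digit i \<in> borel \<rightarrow>\<^sub>M count_space UNIV"
proof (induction i)
  case (Suc i)
  have "(\<lambda>t::real. 3 * t - 2 * of_bool (1 / 2 < t)) \<in> borel \<rightarrow>\<^sub>M borel" by measurable
  from measurable_compose[OF this Suc] show ?case by simp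
next
  case 0
  show ?case by simp
qed

lemma measurable_digits [measurable]: "(\<lambda>t i. digit i t) \<in> borel \<rightarrow>\<^sub>M bits"
  by (rule measurable_PiM_single') auto

text \<open>The distance to 1/2 stays at least 1/6 in the limit, so \<open>t\<close> is strictly on
  one side and the sequence eventually is on the same side.\<close>

lemma half_less_tendsto:
  assumes "(\<lambda>n. ternary (b n)) \<longlonglongrightarrow> t"
  shows "\<forall>\<^sub>F n in sequentially. (1 / 2 < ternary (b n)) = (1 / 2 < t)"
proof -
  have "(\<lambda>n. \<bar>ternary (b n) - 1 / 2\<bar>) \<longlonglongrightarrow> \<bar>t - 1 / 2\<bar>" by (intro tendsto_intros assms)
  then have "\<bar>t - 1 / 2\<bar> \<ge> 1 / 6"
    using ternary_gap by (intro LIMSEQ_le_const[of _ _ "1/6"]) auto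
  then consider "t > 1/2" | "t < 1/2" by fastforce
  then show ?thesis
  proof cases
    case 1
    from order_tendstoD(1)[OF assms this] show ?thesis by eventually_elim (use 1 in auto)
  next
    case 2
    from order_tendstoD(2)[OF assms this] show ?thesis by eventually_elim (use 2 in auto)
  qed
qed

text \<open>The induction must vary \<open>b\<close> and \<open>t\<close>: once the first digit has
  stabilised, the shifted values are again ternary expansions and converge to the shifted
  \<open>t\<close>.\<close>

lemma digit_tendsto:
  assumes "(\<lambda>n. ternary (b n)) \<longlonglongrightarrow> t"
  shows "\<forall>\<^sub>F n in sequentially. digit i (ternary (b n)) = digit i t"
  using assms
proof (induction i arbitrary: b t)
  case 0
  then show ?case using half_less_tendsto by simp
next
  case (Suc i)
  have "(\<lambda>n. 3 * ternary (b n) - 2 * of_bool (1 / 2 < t)) \<longlonglongrightarrow> 3 * t - 2 * of_bool (1 / 2 < t)"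
    by (intro tendsto_intros Suc.prems)
  then have "(\<lambda>n. ternary (\<lambda>i. b n (Suc i))) \<longlonglongrightarrow> 3 * t - 2 * of_bool (1 / 2 < t)"
    by (rule Lim_transform_eventually)
      (use half_less_tendsto[OF Suc.prems] in \<open>eventually_elim, subst ternary_shift[symmetric], simp only:\<close>)
  from Suc.IH[OF this] show ?case by (simp only: digit.simps ternary_shift)
qed

text \<open>The image laws on the line are tight, so Helly gives a weak limit and Skorohod makes the
  convergence pointwise. Reading off digits returns to bits: finitely many digits are eventually
  constant, and Fatou's lemma applies. Since \<open>F\<close> may be \<top> on a cell whose mass
  tends to 0, the inequality cannot be sharpened to a limit.\<close>

lemma prob_bits_seq_compact:
  fixes N :: "nat \<Rightarrow> (nat \<Rightarrow> bool) measure"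
  assumes N: "\<And>n. N n \<in> space (prob_algebra bits)"
  obtains s M where "strict_mono s" "M \<in> space (prob_algebra bits)"
    "\<And>k F. depends_on_first k F \<Longrightarrow>
       (\<integral>\<^sup>+ b. F b \<partial>M) \<le> liminf (\<lambda>n. \<integral>\<^sup>+ b. (F b :: ennreal) \<partial>N (s n))"
proof -
  have setsN [simp, measurable_cong]: "sets (N n) = sets bits" and probN: "prob_space (N n)" for n
    using N[of n] by (auto simp: space_prob_algebra)
  define D where "D n = distr (N n) borel ternary" for n
  interpret D: real_distribution "D n" for n
    unfolding D_def real_distribution_def real_distribution_axioms_def
    by (auto intro!: prob_space.prob_space_distr probN)
  have "tight D"
    unfolding tight_def
  proof (intro conjI allI impI)
    fix e :: real assume "e > 0"
    \<comment> \<open>Tightness is stated with intervals open on the left, so -1 is used in order to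
      include 0.\<close>
    have "measure (D n) {-1<..1} = 1" for n
    proof -
      have "ternary b \<in> {-1<..1}" for b using ternary_nonneg[of b] ternary_le_1[of b] by auto
      then have "ternary -` {-1<..1} \<inter> space (N n) = space (N n)" by auto
      then show ?thesis by (simp add: D_def measure_distr prob_space.prob_space[OF probN])
    qed
    then show "\<exists>a b::real. a < b \<and> (\<forall>n. measure (D n) {a<..b} > 1 - e)"
      using \<open>e > 0\<close> by (intro exI[of _ "-1"] exI[of _ 1]) auto
  qed (rule D.real_distribution_axioms)
  from tight_imp_convergent_subsubsequence[OF this strict_mono_id]
  obtain s Q where s: "strict_mono s" "real_distribution Q" "weak_conv_m (\<lambda>n. D (s n)) Q"
    by (auto simp: o_def)
  from Skorohod[OF D.real_distribution_axioms s(2,3)] obtain \<Omega> :: "real measure" and Ys Y where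
    \<Omega>: "prob_space \<Omega>" and [measurable]: "\<And>n. Ys n \<in> borel_measurable \<Omega>" and
    dYs: "\<And>n. distr \<Omega> borel (Ys n) = D (s n)" and "Y \<in> measurable \<Omega> lborel" and
    lim: "\<And>x. x \<in> space \<Omega> \<Longrightarrow> (\<lambda>n. Ys n x) \<longlonglongrightarrow> Y x"
    by blast
  then have [measurable]: "Y \<in> borel_measurable \<Omega>" by simp
  define M where "M = distr \<Omega> bits (\<lambda>\<omega> i. digit i (Y \<omega>))"
  have "M \<in> space (prob_algebra bits)"
    by (auto simp: M_def space_prob_algebra intro!: prob_space.prob_space_distr \<Omega>)
  \<comment> \<open>The variables \<open>Ys n\<close> are known only through their laws. That they
    lie in the Cantor set is expressed by the re-encoding equation, which carries over between
    variables with the same law.\<close>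
  have "AE \<omega> in \<Omega>. ternary (\<lambda>i. digit i (Ys n \<omega>)) = Ys n \<omega>" for n
  proof -
    have "AE t in D (s n). ternary (\<lambda>i. digit i t) = t"
      unfolding D_def by (subst AE_distr_iff) (auto simp: digit_ternary)
    then have "AE t in distr \<Omega> borel (Ys n). ternary (\<lambda>i. digit i t) = t" by (simp only: dYs)
    then show ?thesis by (subst (asm) AE_distr_iff) auto
  qed
  then have AE: "AE \<omega> in \<Omega>. \<forall>n. ternary (\<lambda>i. digit i (Ys n \<omega>)) = Ys n \<omega>"
    by (simp add: AE_all_countable)
  have fatou: "(\<integral>\<^sup>+ b. F b \<partial>M) \<le> liminf (\<lambda>n. \<integral>\<^sup>+ b. (F b :: ennreal) \<partial>N (s n))"
    if F: "depends_on_first k F" for k F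
  proof -
    have Fm [measurable]: "F \<in> borel_measurable bits"
      by (rule depends_on_first_measurable[OF F]) auto
    have "(\<integral>\<^sup>+ b. F b \<partial>M) = (\<integral>\<^sup>+ \<omega>. F (\<lambda>i. digit i (Y \<omega>)) \<partial>\<Omega>)"
      unfolding M_def by (rule nn_integral_distr) auto
    also have "\<dots> \<le> (\<integral>\<^sup>+ \<omega>. liminf (\<lambda>n. F (\<lambda>i. digit i (Ys n \<omega>))) \<partial>\<Omega>)"
    proof (rule nn_integral_mono_AE, use AE AE_space in eventually_elim)
      fix \<omega> assume eq: "\<forall>n. ternary (\<lambda>i. digit i (Ys n \<omega>)) = Ys n \<omega>" and \<omega>: "\<omega> \<in> space \<Omega>"
      have "\<forall>\<^sub>F n in sequentially. digit i (Ys n \<omega>) = digit i (Y \<omega>)" for i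
        using digit_tendsto[of "\<lambda>n i. digit i (Ys n \<omega>)" "Y \<omega>" i] lim[OF \<omega>] eq by simp
      then have "\<forall>\<^sub>F n in sequentially. \<forall>i\<in>{..<k}. digit i (Ys n \<omega>) = digit i (Y \<omega>)"
        by (intro eventually_ball_finite) auto
      then have "\<forall>\<^sub>F n in sequentially. F (\<lambda>i. digit i (Y \<omega>)) \<le> F (\<lambda>i. digit i (Ys n \<omega>))"
        by eventually_elim
          (use F in \<open>auto simp: depends_on_first_def intro!: eq_refl\<close>)
      then show "F (\<lambda>i. digit i (Y \<omega>)) \<le> liminf (\<lambda>n. F (\<lambda>i. digit i (Ys n \<omega>)))"
        by (intro Liminf_bounded) 
    qed
    also have "\<dots> \<le> liminf (\<lambda>n. \<integral>\<^sup>+ \<omega>. F (\<lambda>i. digit i (Ys n \<omega>)) \<partial>\<Omega>)"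
      by (intro nn_integral_liminf) auto
    also have "(\<lambda>n. \<integral>\<^sup>+ \<omega>. F (\<lambda>i. digit i (Ys n \<omega>)) \<partial>\<Omega>) = (\<lambda>n. \<integral>\<^sup>+ b. F b \<partial>N (s n))"
    proof
      fix n
      have "(\<integral>\<^sup>+ \<omega>. F (\<lambda>i. digit i (Ys n \<omega>)) \<partial>\<Omega>) = (\<integral>\<^sup>+ t. F (\<lambda>i. digit i t) \<partial>distr \<Omega> borel (Ys n))"
        by (rule nn_integral_distr[symmetric]) auto
      also have "\<dots> = (\<integral>\<^sup>+ b. F (\<lambda>i. digit i (ternary b)) \<partial>N (s n))"
        unfolding dYs D_def by (rule nn_integral_distr) auto
      finally show "(\<integral>\<^sup>+ \<omega>. F (\<lambda>i. digit i (Ys n \<omega>)) \<partial>\<Omega>) = (\<integral>\<^sup>+ b. F b \<partial>N (s n))"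
        by (simp add: digit_ternary)
    qed
    finally show ?thesis .
  qed
  show ?thesis by (rule that[OF s(1) \<open>M \<in> _\<close> fatou])
qed

text \<open>A one-sided comparison suffices: applied to a cylinder and to its complement it gives
  both inequalities, because the total masses are 1.\<close>

lemma prob_bits_eqI:
  assumes "M1 \<in> space (prob_algebra bits)" "M2 \<in> space (prob_algebra bits)"
    and le: "\<And>k F. depends_on_first k F \<Longrightarrow> (\<integral>\<^sup>+ b. F b \<partial>M1) \<le> (\<integral>\<^sup>+ b. (F b :: ennreal) \<partial>M2)"
  shows "M1 = M2"
proof (rule measure_eqI_PiM_infinite[where I = UNIV and M = "\<lambda>_. count_space UNIV"])
  have sets [simp, measurable_cong]: "sets M1 = sets bits" "sets M2 = sets bits"
    and prob: "prob_space M1" "prob_space M2"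
    using assms by (auto simp: space_prob_algebra)
  show "sets M1 = sets bits" "sets M2 = sets bits" by auto
  interpret M1: prob_space M1 by fact
  interpret M2: prob_space M2 by fact
  show "finite_measure M1" by (rule M1.finite_measure_axioms)
  fix A :: "nat \<Rightarrow> bool set" and J :: "nat set"
  assume J: "finite J"
  obtain k where k: "\<And>i. i \<in> J \<Longrightarrow> i < k" using finite_nat_set_iff_bounded J by auto
  let ?E = "prod_emb UNIV (\<lambda>_. count_space UNIV) J (Pi\<^sub>E J A)"
  have E_eq: "?E = {b. \<forall>i\<in>J. b i \<in> A i}" by (auto simp: prod_emb_def restrict_def PiE_iff space_PiM)
  have E: "?E \<in> sets bits" using J by (intro sets_PiM_I) auto
  have dep: "depends_on_first k (\<lambda>b. indicator ?E b :: ennreal)" 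
    "depends_on_first k (\<lambda>b. indicator (- ?E) b :: ennreal)"
    unfolding depends_on_first_def E_eq indicator_def using k by force+
  have sp: "space M1 = UNIV" "space M2 = UNIV"
    using sets[THEN sets_eq_imp_space_eq] by (auto simp: space_PiM)
  have E': "- ?E \<in> sets bits" using sets.compl_sets[OF E] by (simp add: space_PiM Compl_eq_Diff_UNIV)
  have 1: "emeasure M1 ?E \<le> emeasure M2 ?E" using le[OF dep(1)] E by simp
  have "emeasure M1 (- ?E) \<le> emeasure M2 (- ?E)" using le[OF dep(2)] E' by simp
  then have "measure M1 (- ?E) \<le> measure M2 (- ?E)" 
    by (simp add: M1.emeasure_eq_measure M2.emeasure_eq_measure)
  then have "measure M2 ?E \<le> measure M1 ?E"
    using M1.prob_compl[of ?E] M2.prob_compl[of ?E] E by (simp add: sp Compl_eq_Diff_UNIV)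
  with 1 show "emeasure M1 ?E = emeasure M2 ?E"
    by (simp add: M1.emeasure_eq_measure M2.emeasure_eq_measure)
qed

section \<open>Coding points of a Polish space\<close>

lemma measurable_code [measurable]:
  "(\<And>i. C i \<in> sets M) \<Longrightarrow> (\<lambda>x i. x \<in> C i) \<in> M \<rightarrow>\<^sub>M bits"
  by (rule measurable_PiM_single') auto

text \<open>Take a representative of the first listed set of diameter below 1/(m+1) that contains
  the point. For the code of \<open>x\<close> these representatives converge to \<open>x\<close>,
  and the limit is a measurable function of the code.\<close>

lemma code_left_inverse:
  fixes C :: "nat \<Rightarrow> 'a::polish_space set"
  assumes small: "\<And>x e. e > 0 \<Longrightarrow> \<exists>i. x \<in> C i \<and> (\<forall>u\<in>C i. \<forall>v\<in>C i. dist u v < e)"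
  obtains \<pi> where "\<pi> \<in> bits \<rightarrow>\<^sub>M borel" "\<And>x. \<pi> (\<lambda>i. x \<in> C i) = x"
proof -
  define Q where "Q m j = (\<forall>u\<in>C j. \<forall>v\<in>C j. dist u v < 1 / real (Suc m))" for m j
  define p where "p j = (SOME u. u \<in> C j)" for j
  define f where "f m s = p (LEAST j. s j \<and> Q m j)" for m and s :: "nat \<Rightarrow> bool"
  \<comment> \<open>A bit sequence that codes no point may give a divergent \<open>f\<close>.
    Freezing it at \<open>p 0\<close> there makes the sequence converge everywhere, as measurability
    of the limit requires.\<close>
  define g where "g m s = (if Cauchy (\<lambda>m. f m s) then f m s else p 0)" for m s
  have [measurable]: "f m \<in> bits \<rightarrow>\<^sub>M borel" for m
  proof -
    have "(\<lambda>s. LEAST j. s j \<and> Q m j) \<in> bits \<rightarrow>\<^sub>M count_space UNIV" by measurable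
    moreover have "p \<in> count_space UNIV \<rightarrow>\<^sub>M borel" by simp
    ultimately show ?thesis unfolding f_def by (rule measurable_compose)
  qed
  have [measurable]: "g m \<in> bits \<rightarrow>\<^sub>M borel" for m
    unfolding g_def by measurable
  have conv: "(\<lambda>m. g m s) \<longlonglongrightarrow> lim (\<lambda>m. g m s)" for s
    unfolding convergent_LIMSEQ_iff[symmetric]
    by (cases "Cauchy (\<lambda>m. f m s)") (auto simp: g_def Cauchy_convergent convergent_const)
  have near: "dist (f m (\<lambda>i. x \<in> C i)) x < 1 / real (Suc m)" for m x
  proof -
    let ?j = "LEAST j. x \<in> C j \<and> Q m j"
    have "\<exists>j. x \<in> C j \<and> Q m j" using small[of "1 / real (Suc m)" x] by (auto simp: Q_def)
    then have j: "x \<in> C ?j \<and> Q m ?j" by (rule LeastI_ex)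
    then have "p ?j \<in> C ?j" unfolding p_def by (metis someI)
    with j show ?thesis unfolding f_def Q_def by auto
  qed
  show ?thesis
  proof (rule that)
    show "(\<lambda>s. lim (\<lambda>m. g m s)) \<in> bits \<rightarrow>\<^sub>M borel"
      by (rule borel_measurable_LIMSEQ_metric[of g]) (use conv in auto)
    fix x
    have "(\<lambda>m. dist (f m (\<lambda>i. x \<in> C i)) x) \<longlonglongrightarrow> 0"
      by (rule tendsto_sandwich[OF _ _ tendsto_const LIMSEQ_inverse_real_of_nat])
        (use near[of _ x, THEN less_imp_le] in \<open>auto simp: inverse_eq_divide\<close>)
    then have lim: "(\<lambda>m. f m (\<lambda>i. x \<in> C i)) \<longlonglongrightarrow> x" by (rule tendsto_dist_iff[THEN iffD2])
    then have "Cauchy (\<lambda>m. f m (\<lambda>i. x \<in> C i))" by (rule LIMSEQ_imp_Cauchy)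
    with lim have "(\<lambda>m. g m (\<lambda>i. x \<in> C i)) \<longlonglongrightarrow> x" by (simp add: g_def)
    then show "lim (\<lambda>m. g m (\<lambda>i. x \<in> C i)) = x" by (rule limI)
  qed
qed

section \<open>Couplings with prescribed cell masses\<close>

lemma couplingsD:
  assumes "\<upsilon> \<in> couplings \<mu> \<nu>"
  shows "prob_space \<upsilon>" "sets \<upsilon> = sets (borel \<Otimes>\<^sub>M borel)"
    "distr \<upsilon> borel fst = \<mu>" "distr \<upsilon> borel snd = \<nu>"
  using assms by (auto simp: couplings_def space_prob_algebra)

lemma couplings_nn_integral:
  assumes "\<upsilon> \<in> couplings \<mu> \<nu>" and [measurable]: "f \<in> borel_measurable borel"
  shows "(\<integral>\<^sup>+ z. f (fst z) \<partial>\<upsilon>) = (\<integral>\<^sup>+ x. f x \<partial>\<mu>)" "(\<integral>\<^sup>+ z. f (snd z) \<partial>\<upsilon>) = (\<integral>\<^sup>+ x. f x \<partial>\<nu>)"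
proof -
  note * = couplingsD[OF assms(1)]
  note [measurable_cong] = *(2)
  show "(\<integral>\<^sup>+ z. f (fst z) \<partial>\<upsilon>) = (\<integral>\<^sup>+ x. f x \<partial>\<mu>)" unfolding *(3)[symmetric]
    by (rule nn_integral_distr[symmetric]) auto
  show "(\<integral>\<^sup>+ z. f (snd z) \<partial>\<upsilon>) = (\<integral>\<^sup>+ x. f x \<partial>\<nu>)" unfolding *(4)[symmetric]
    by (rule nn_integral_distr[symmetric]) auto
qed

lemma pair_measure_in_couplings:
  fixes \<mu> \<nu> :: "'a::second_countable_topology measure"
  assumes "\<mu> \<in> space (prob_algebra borel)" "\<nu> \<in> space (prob_algebra borel)"
  shows "\<mu> \<Otimes>\<^sub>M \<nu> \<in> couplings \<mu> \<nu>"
proof -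
  have *: "sets \<mu> = sets borel" "sets \<nu> = sets borel" "prob_space \<mu>" "prob_space \<nu>"
    using assms by (auto simp: space_prob_algebra)
  interpret \<mu>: prob_space \<mu> by fact
  interpret \<nu>: prob_space \<nu> by fact
  interpret pair_prob_space \<mu> \<nu> ..
  have "distr (\<mu> \<Otimes>\<^sub>M \<nu>) borel fst = distr (\<mu> \<Otimes>\<^sub>M \<nu>) \<mu> fst"
    "distr (\<mu> \<Otimes>\<^sub>M \<nu>) borel snd = distr (\<mu> \<Otimes>\<^sub>M \<nu>) \<nu> snd"
    by (auto intro!: distr_cong simp: *)
  \<comment> \<open>The second marginal is reduced to the first by swapping the factors.\<close>
  moreover have "distr (\<mu> \<Otimes>\<^sub>M \<nu>) \<nu> snd = \<nu>"
  proof -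
    have "distr (\<mu> \<Otimes>\<^sub>M \<nu>) \<nu> snd = distr (distr (\<nu> \<Otimes>\<^sub>M \<mu>) (\<mu> \<Otimes>\<^sub>M \<nu>) (\<lambda>(x, y). (y, x))) \<nu> snd"
      using distr_pair_swap by simp
    also have "\<dots> = distr (\<nu> \<Otimes>\<^sub>M \<mu>) \<nu> fst"
      by (subst distr_distr) (auto simp: comp_def split_beta)
    finally show ?thesis by (simp add: \<mu>.distr_pair_fst)
  qed
  ultimately show ?thesis
    unfolding couplings_def space_prob_algebra
    by (auto simp: \<nu>.distr_pair_fst * prob_space_axioms intro!: sets_pair_measure_cong)
qed

text \<open>A product of discrete \<sigma>-algebras can fail to be discrete on a large type, so the
  code is first restricted to its finite range; there an arbitrary \<open>F\<close> is
  measurable.\<close>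

lemma measurable_finite_code_pair:
  fixes F :: "'c \<Rightarrow> 'c \<Rightarrow> ennreal"
  assumes c: "c \<in> M \<rightarrow>\<^sub>M count_space UNIV" and I: "finite I" "range c \<subseteq> I"
  shows "(\<lambda>z. F (c (fst z)) (c (snd z))) \<in> borel_measurable (M \<Otimes>\<^sub>M M)"
proof -
  have [measurable]: "c \<in> M \<rightarrow>\<^sub>M count_space I"
    using I measurable_sets[OF c] by (intro measurable_count_space_eq2[THEN iffD2]) auto
  have "(\<lambda>z. (c (fst z), c (snd z))) \<in> M \<Otimes>\<^sub>M M \<rightarrow>\<^sub>M count_space (I \<times> I)"
    using I by (subst pair_measure_count_space[symmetric]) auto
  from measurable_compose[OF this, of "\<lambda>(i, j). F i j" borel] show ?thesis by simp
qed

text \<open>The coupling has density \<open>w i j / (\<alpha>(c = i) \<beta>(c = j))\<close> with respect to \<open>\<alpha> \<otimes> \<beta>\<close>; where the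
  denominator vanishes the junk value \<open>0 / 0 = 0\<close> is harmless, since then \<open>w i j = 0\<close>.\<close>

lemma coupling_of_matrix:
  fixes \<alpha> \<beta> :: "'a::second_countable_topology measure" and c :: "'a \<Rightarrow> 'c"
    and w :: "'c \<Rightarrow> 'c \<Rightarrow> ennreal"
  assumes \<alpha>: "\<alpha> \<in> space (prob_algebra borel)" and \<beta>: "\<beta> \<in> space (prob_algebra borel)"
    and c [measurable]: "c \<in> borel \<rightarrow>\<^sub>M count_space UNIV" and I: "finite I" "range c \<subseteq> I"
    and row: "\<And>i. i \<in> I \<Longrightarrow> (\<Sum>j\<in>I. w i j) = emeasure \<alpha> (c -` {i})"
    and col: "\<And>j. j \<in> I \<Longrightarrow> (\<Sum>i\<in>I. w i j) = emeasure \<beta> (c -` {j})"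
  obtains \<upsilon> where "\<upsilon> \<in> couplings \<alpha> \<beta>"
    "\<And>F. (\<integral>\<^sup>+ z. F (c (fst z)) (c (snd z)) \<partial>\<upsilon>) = (\<Sum>i\<in>I. \<Sum>j\<in>I. F i j * w i j)"
proof -
  have [simp, measurable_cong]: "sets \<alpha> = sets borel" "sets \<beta> = sets borel"
    and prob: "prob_space \<alpha>" "prob_space \<beta>"
    using \<alpha> \<beta> by (auto simp: space_prob_algebra)
  interpret \<alpha>: prob_space \<alpha> by fact
  interpret \<beta>: prob_space \<beta> by fact
  interpret \<alpha>\<beta>: pair_prob_space \<alpha> \<beta> ..
  define A where "A i = emeasure \<alpha> (c -` {i})" for i
  define B where "B i = emeasure \<beta> (c -` {i})" for i
  have fin: "A i \<noteq> \<top>" "B i \<noteq> \<top>" for i by (auto simp: A_def B_def)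
  have cs [measurable]: "c -` {i} \<in> sets borel" for i
    using measurable_sets[OF c, of "{i}"] by simp
  define D where "D z = w (c (fst z)) (c (snd z)) / (A (c (fst z)) * B (c (snd z)))" for z
  note meas [measurable] = measurable_finite_code_pair[OF c I]
  have Dm [measurable]: "D \<in> borel_measurable (borel \<Otimes>\<^sub>M borel)"
    unfolding D_def by (rule meas)
  have sum_ind: "G (c x) = (\<Sum>i\<in>I. G i * indicator (c -` {i}) x)" for G :: "'c \<Rightarrow> ennreal" and x
  proof -
    have "(\<Sum>i\<in>I. G i * indicator (c -` {i}) x) = (\<Sum>i\<in>I. if i = c x then G i else 0)"
      by (intro sum.cong) (auto simp: indicator_def)
    then show ?thesis using I by (auto simp: sum.delta)
  qed
  have int_cell: "(\<integral>\<^sup>+ x. G (c x) \<partial>M) = (\<Sum>i\<in>I. G i * emeasure M (c -` {i}))"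
    if [simp, measurable_cong]: "sets M = sets borel" for G :: "'c \<Rightarrow> ennreal" and M
    by (subst sum_ind, subst nn_integral_sum) (auto simp: nn_integral_cmult_indicator)
  \<comment> \<open>A null cell has zero row or column sum, and all the entries are
    nonnegative.\<close>
  have w0: "w i j = 0" if "A i * B j = 0" "i \<in> I" "j \<in> I" for i j
    using row[OF that(2)] col[OF that(3)] that I by (auto simp: A_def B_def)
  have cancel: "w i j / (A i * B j) * A i * B j = w i j" if "i \<in> I" "j \<in> I" for i j
  proof (cases "A i * B j = 0")
    case True
    then show ?thesis using w0[OF True that] by simp
  next
    case False
    moreover have "A i * B j \<noteq> \<top>" using fin[of i] fin(2)[of j] by (simp add: ennreal_mult_eq_top_iff)
    ultimately have "w i j * (A i * B j) / (A i * B j) = w i j" by (rule mult_divide_eq_ennreal)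
    then show ?thesis by (simp add: ennreal_times_divide mult_ac)
  qed
  \<comment> \<open>Integrating the density over one variable gives 1 almost everywhere in the
    other. The claim is kept abstract so that it serves both marginals, the second one with
    \<open>w\<close> transposed. Points in null cells are the exceptions.\<close>
  have total: "AE x in M. (\<Sum>j\<in>I. u (c x) j / (A' (c x) * B' j) * B' j) = 1"
    if [simp, measurable_cong]: "sets M = sets borel" and A': "\<And>i. A' i = emeasure M (c -` {i})" "\<And>i. A' i \<noteq> \<top>"
    and row': "\<And>i. i \<in> I \<Longrightarrow> (\<Sum>j\<in>I. u i j) = A' i"
    and cancel': "\<And>i j. i \<in> I \<Longrightarrow> j \<in> I \<Longrightarrow> u i j / (A' i * B' j) * A' i * B' j = u i j"
    for M and A' B' :: "'c \<Rightarrow> ennreal" and u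
  proof -
    have "AE x in M. \<forall>i\<in>{i\<in>I. A' i = 0}. x \<notin> c -` {i}"
      using I by (intro AE_finite_allI AE_not_in) (auto simp: null_sets_def A')
    then have "AE x in M. A' (c x) \<noteq> 0"
      by eventually_elim (use I in auto)
    then show ?thesis
    proof eventually_elim
      fix x assume x: "A' (c x) \<noteq> 0"
      have cI: "c x \<in> I" using I by auto
      have "A' (c x) * (\<Sum>j\<in>I. u (c x) j / (A' (c x) * B' j) * B' j) = (\<Sum>j\<in>I. u (c x) j)"
        unfolding sum_distrib_left
        by (intro sum.cong refl) (use cancel'[OF cI] in \<open>simp add: mult_ac\<close>)
      then have "A' (c x) * (\<Sum>j\<in>I. u (c x) j / (A' (c x) * B' j) * B' j) = A' (c x) * 1"
        using row'[OF cI] by simp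
      then show "(\<Sum>j\<in>I. u (c x) j / (A' (c x) * B' j) * B' j) = 1"
        using x A'(2)[of "c x"] by (simp only: ennreal_mult_cancel_left) auto
    qed
  qed
  define \<upsilon> where "\<upsilon> = density (\<alpha> \<Otimes>\<^sub>M \<beta>) D"
  have [measurable_cong]: "sets (\<alpha> \<Otimes>\<^sub>M \<beta>) = sets (borel \<Otimes>\<^sub>M borel)"
    by (intro sets_pair_measure_cong) auto
  have sets_\<upsilon> [simp, measurable_cong]: "sets \<upsilon> = sets (borel \<Otimes>\<^sub>M borel)"
    unfolding \<upsilon>_def by (simp cong: sets_pair_measure_cong)
  have cost: "(\<integral>\<^sup>+ z. F (c (fst z)) (c (snd z)) \<partial>\<upsilon>) = (\<Sum>i\<in>I. \<Sum>j\<in>I. F i j * w i j)" for F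
  proof -
    have "(\<integral>\<^sup>+ z. F (c (fst z)) (c (snd z)) \<partial>\<upsilon>) = (\<integral>\<^sup>+ z. D z * F (c (fst z)) (c (snd z)) \<partial>(\<alpha> \<Otimes>\<^sub>M \<beta>))"
      unfolding \<upsilon>_def by (rule nn_integral_density) measurable
    also have "\<dots> = (\<integral>\<^sup>+ x. \<integral>\<^sup>+ y. w (c x) (c y) / (A (c x) * B (c y)) * F (c x) (c y) \<partial>\<beta> \<partial>\<alpha>)"
      by (subst \<beta>.nn_integral_fst[symmetric]) (auto simp: D_def)
    also have "\<dots> = (\<Sum>i\<in>I. (\<Sum>j\<in>I. w i j / (A i * B j) * F i j * B j) * A i)"
    proof -
      have "(\<integral>\<^sup>+ y. w (c x) (c y) / (A (c x) * B (c y)) * F (c x) (c y) \<partial>\<beta>)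
          = (\<Sum>j\<in>I. w (c x) j / (A (c x) * B j) * F (c x) j * B j)" for x
        using int_cell[of \<beta> "\<lambda>j. w (c x) j / (A (c x) * B j) * F (c x) j"] by (simp add: B_def)
      then show ?thesis
        using int_cell[of \<alpha> "\<lambda>i. \<Sum>j\<in>I. w i j / (A i * B j) * F i j * B j"] by (simp add: A_def)
    qed
    also have "\<dots> = (\<Sum>i\<in>I. \<Sum>j\<in>I. F i j * (w i j / (A i * B j) * A i * B j))"
      by (simp add: sum_distrib_left mult_ac)
    also have "\<dots> = (\<Sum>i\<in>I. \<Sum>j\<in>I. F i j * w i j)"
      by (intro sum.cong refl) (simp add: cancel)
    finally show ?thesis .
  qed
  have m1: "emeasure (distr \<upsilon> borel fst) E = emeasure \<alpha> E" if E [measurable]: "E \<in> sets borel" for E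
  proof -
    have "emeasure (distr \<upsilon> borel fst) E = (\<integral>\<^sup>+ z. indicator E (fst z) \<partial>\<upsilon>)"
      using nn_integral_distr[of fst \<upsilon> borel "indicator E"] by simp
    also have "\<dots> = (\<integral>\<^sup>+ z. D z * indicator E (fst z) \<partial>(\<alpha> \<Otimes>\<^sub>M \<beta>))"
      unfolding \<upsilon>_def by (rule nn_integral_density) measurable
    also have "\<dots> = (\<integral>\<^sup>+ x. \<integral>\<^sup>+ y. w (c x) (c y) / (A (c x) * B (c y)) * indicator E x \<partial>\<beta> \<partial>\<alpha>)"
      by (subst \<beta>.nn_integral_fst[symmetric]) (auto simp: D_def)
    also have "\<dots> = (\<integral>\<^sup>+ x. indicator E x * (\<Sum>j\<in>I. w (c x) j / (A (c x) * B j) * B j) \<partial>\<alpha>)"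
    proof (rule nn_integral_cong)
      fix x
      have "(\<integral>\<^sup>+ y. w (c x) (c y) / (A (c x) * B (c y)) * indicator E x \<partial>\<beta>)
          = (\<Sum>j\<in>I. w (c x) j / (A (c x) * B j) * indicator E x * B j)"
        using int_cell[of \<beta> "\<lambda>j. w (c x) j / (A (c x) * B j) * indicator E x"] by (simp add: B_def)
      then show "(\<integral>\<^sup>+ y. w (c x) (c y) / (A (c x) * B (c y)) * indicator E x \<partial>\<beta>)
          = indicator E x * (\<Sum>j\<in>I. w (c x) j / (A (c x) * B j) * B j)"
        by (simp add: sum_distrib_left mult_ac)
    qed
    also have "\<dots> = (\<integral>\<^sup>+ x. indicator E x \<partial>\<alpha>)"
    proof (rule nn_integral_cong_AE)
      have "AE x in \<alpha>. (\<Sum>j\<in>I. w (c x) j / (A (c x) * B j) * B j) = 1"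
        by (rule total[OF _ A_def fin(1) row[folded A_def] cancel]) auto
      then show "AE x in \<alpha>. indicator E x * (\<Sum>j\<in>I. w (c x) j / (A (c x) * B j) * B j) = indicator E x"
        by eventually_elim simp
    qed
    finally show ?thesis by simp
  qed
  have m2: "emeasure (distr \<upsilon> borel snd) E = emeasure \<beta> E" if E [measurable]: "E \<in> sets borel" for E
  proof -
    have "emeasure (distr \<upsilon> borel snd) E = (\<integral>\<^sup>+ z. indicator E (snd z) \<partial>\<upsilon>)"
      using nn_integral_distr[of snd \<upsilon> borel "indicator E"] by simp
    also have "\<dots> = (\<integral>\<^sup>+ z. D z * indicator E (snd z) \<partial>(\<alpha> \<Otimes>\<^sub>M \<beta>))"
      unfolding \<upsilon>_def by (rule nn_integral_density) measurable
    also have "\<dots> = (\<integral>\<^sup>+ y. \<integral>\<^sup>+ x. w (c x) (c y) / (A (c x) * B (c y)) * indicator E y \<partial>\<alpha> \<partial>\<beta>)"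
      by (subst \<alpha>\<beta>.nn_integral_snd[symmetric]) (auto simp: D_def)
    also have "\<dots> = (\<integral>\<^sup>+ y. indicator E y * (\<Sum>i\<in>I. w i (c y) / (A i * B (c y)) * A i) \<partial>\<beta>)"
    proof (rule nn_integral_cong)
      fix y
      have "(\<integral>\<^sup>+ x. w (c x) (c y) / (A (c x) * B (c y)) * indicator E y \<partial>\<alpha>)
          = (\<Sum>i\<in>I. w i (c y) / (A i * B (c y)) * indicator E y * A i)"
        using int_cell[of \<alpha> "\<lambda>i. w i (c y) / (A i * B (c y)) * indicator E y"] by (simp add: A_def)
      then show "(\<integral>\<^sup>+ x. w (c x) (c y) / (A (c x) * B (c y)) * indicator E y \<partial>\<alpha>)
          = indicator E y * (\<Sum>i\<in>I. w i (c y) / (A i * B (c y)) * A i)"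
        by (simp add: sum_distrib_left mult_ac)
    qed
    also have "\<dots> = (\<integral>\<^sup>+ x. indicator E x \<partial>\<beta>)"
    proof (rule nn_integral_cong_AE)
      have "AE y in \<beta>. (\<Sum>i\<in>I. w i (c y) / (B (c y) * A i) * A i) = 1"
        by (rule total[of \<beta> B "\<lambda>j i. w i j" A, OF _ B_def fin(2) col[folded B_def]])
          (use cancel in \<open>auto simp: mult_ac\<close>)
      then show "AE y in \<beta>. indicator E y * (\<Sum>i\<in>I. w i (c y) / (A i * B (c y)) * A i) = indicator E y"
        by eventually_elim (simp add: mult.commute)
    qed
    finally show ?thesis by simp
  qed
  have d1: "distr \<upsilon> borel fst = \<alpha>" by (rule measure_eqI) (auto simp: m1)
  have d2: "distr \<upsilon> borel snd = \<beta>" by (rule measure_eqI) (auto simp: m2)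
  \<comment> \<open>The total mass is inherited from the first marginal, which is already known to
    be \<alpha>.\<close>
  have "prob_space \<upsilon>"
    by (rule prob_space_distrD[of fst _ borel]) (auto simp: d1 prob)
  then have "\<upsilon> \<in> couplings \<alpha> \<beta>" by (simp add: couplings_def space_prob_algebra d1 d2)
  then show ?thesis using that cost by blast
qed

section \<open>Cell masses of couplings and completion of deficient matrices\<close>

lemma nn_integral_finite_code_pair:
  fixes c :: "'a::second_countable_topology \<Rightarrow> 'c" and F :: "'c \<Rightarrow> 'c \<Rightarrow> ennreal"
  assumes c [measurable]: "c \<in> borel \<rightarrow>\<^sub>M count_space UNIV" and I: "finite I" "range c \<subseteq> I"
    and [simp, measurable_cong]: "sets \<gamma> = sets (borel \<Otimes>\<^sub>M borel)"
  shows "(\<integral>\<^sup>+ z. F (c (fst z)) (c (snd z)) \<partial>\<gamma>)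
      = (\<Sum>i\<in>I. \<Sum>j\<in>I. F i j * emeasure \<gamma> {z. c (fst z) = i \<and> c (snd z) = j})"
proof -
  have sp: "space \<gamma> = UNIV"
    using sets_eq_imp_space_eq[of \<gamma> "borel \<Otimes>\<^sub>M borel"] by (simp add: space_pair_measure)
  have cell [measurable]: "{z. c (fst z) = i \<and> c (snd z) = j} \<in> sets (borel \<Otimes>\<^sub>M borel)" for i j
  proof -
    have "{z \<in> space \<gamma>. c (fst z) = i \<and> c (snd z) = j} \<in> sets \<gamma>" by measurable
    then show ?thesis by (simp add: sp)
  qed
  have "F (c (fst z)) (c (snd z))
      = (\<Sum>i\<in>I. \<Sum>j\<in>I. F i j * indicator {z. c (fst z) = i \<and> c (snd z) = j} z)" for z
  proof -
    have "(\<Sum>j\<in>I. F i j * indicator {z. c (fst z) = i \<and> c (snd z) = j} z)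
        = (if i = c (fst z) then F i (c (snd z)) else 0)" for i
    proof -
      have "(\<Sum>j\<in>I. F i j * indicator {z. c (fst z) = i \<and> c (snd z) = j} z)
        = (\<Sum>j\<in>I. if j = c (snd z) then (if i = c (fst z) then F i j else 0) else 0)"
        by (intro sum.cong) (auto simp: indicator_def)
      then show ?thesis using I by (auto simp: sum.delta)
    qed
    then show ?thesis using I by (auto simp: sum.delta)
  qed
  then show ?thesis
    by (simp add: nn_integral_sum nn_integral_cmult_indicator cell)
qed

lemma sum_emeasure_finite_code:
  fixes c :: "'a::topological_space \<Rightarrow> 'c"
  assumes c [measurable]: "c \<in> borel \<rightarrow>\<^sub>M count_space UNIV" and I: "finite I" "range c \<subseteq> I"
    and \<alpha>: "\<alpha> \<in> space (prob_algebra borel)"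
  shows "(\<Sum>i\<in>I. emeasure \<alpha> (c -` {i})) = 1"
proof -
  have [simp]: "sets \<alpha> = sets borel" and "prob_space \<alpha>" using \<alpha> by (auto simp: space_prob_algebra)
  then interpret prob_space \<alpha> by simp
  have sp: "space \<alpha> = UNIV" using sets_eq_imp_space_eq[of \<alpha> borel] by simp
  have "(\<Sum>i\<in>I. emeasure \<alpha> (c -` {i})) = emeasure \<alpha> (\<Union>i\<in>I. c -` {i})"
    using I measurable_sets[OF c]
    by (intro sum_emeasure) (auto simp: disjoint_family_on_def)
  also have "(\<Union>i\<in>I. c -` {i}) = space \<alpha>" using I by (auto simp: sp)
  finally show ?thesis by (simp add: emeasure_space_1)
qed

text \<open>The mass missing from the rows equals the mass missing from the columns. Adding the
  normalised product of the two residuals restores both marginals, and this extra mass, at most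
  \<delta>, costs at most \<open>K\<close> per unit.\<close>

lemma coupling_of_submatrix:
  fixes \<alpha> \<beta> :: "'a::second_countable_topology measure" and c :: "'a \<Rightarrow> 'c"
    and w F :: "'c \<Rightarrow> 'c \<Rightarrow> ennreal"
  assumes \<alpha>: "\<alpha> \<in> space (prob_algebra borel)" and \<beta>: "\<beta> \<in> space (prob_algebra borel)"
    and c [measurable]: "c \<in> borel \<rightarrow>\<^sub>M count_space UNIV" and I: "finite I" "range c \<subseteq> I"
    and row: "\<And>i. i \<in> I \<Longrightarrow> (\<Sum>j\<in>I. w i j) \<le> emeasure \<alpha> (c -` {i})"
    and col: "\<And>j. j \<in> I \<Longrightarrow> (\<Sum>i\<in>I. w i j) \<le> emeasure \<beta> (c -` {j})"
    and total: "1 \<le> (\<Sum>i\<in>I. \<Sum>j\<in>I. w i j) + \<delta>"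
    and F: "\<And>i j. F i j \<le> K"
  obtains \<upsilon> where "\<upsilon> \<in> couplings \<alpha> \<beta>"
    "(\<integral>\<^sup>+ z. F (c (fst z)) (c (snd z)) \<partial>\<upsilon>) \<le> (\<Sum>i\<in>I. \<Sum>j\<in>I. F i j * w i j) + K * \<delta>"
proof -
  define r where "r i = emeasure \<alpha> (c -` {i}) - (\<Sum>j\<in>I. w i j)" for i
  define s where "s j = emeasure \<beta> (c -` {j}) - (\<Sum>i\<in>I. w i j)" for j
  define W where "W = (\<Sum>i\<in>I. \<Sum>j\<in>I. w i j)"
  have W': "W = (\<Sum>j\<in>I. \<Sum>i\<in>I. w i j)" unfolding W_def by (rule sum.swap)
  have r: "(\<Sum>j\<in>I. w i j) + r i = emeasure \<alpha> (c -` {i})" if "i \<in> I" for i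
    unfolding r_def using row[OF that] by (simp add: add_diff_eq_iff_ennreal)
  have s: "(\<Sum>i\<in>I. w i j) + s j = emeasure \<beta> (c -` {j})" if "j \<in> I" for j
    unfolding s_def using col[OF that] by (simp add: add_diff_eq_iff_ennreal)
  have R: "W + sum r I = 1"
    unfolding W_def sum.distrib[symmetric] using sum_emeasure_finite_code[OF c I \<alpha>] by (simp add: r)
  have S: "W + sum s I = 1"
    unfolding W' sum.distrib[symmetric] using sum_emeasure_finite_code[OF c I \<beta>] by (simp add: s)
  have W_fin: "W \<noteq> \<top>" using R by auto
  have RS: "sum s I = sum r I" using R S W_fin by (metis ennreal_add_left_cancel infinity_ennreal_def)
  have R_fin: "sum r I \<noteq> \<top>" using R by auto
  have R_le: "sum r I \<le> \<delta>" using R total W_fin unfolding W_def[symmetric] by (metis ennreal_add_left_cancel_le infinity_ennreal_def)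
  have R0: "r i = 0" "s i = 0" if "sum r I = 0" "i \<in> I" for i
    using that RS I by (auto simp: sum_eq_0_iff)
  have divR: "x * sum r I / sum r I = x" if "sum r I \<noteq> 0" for x
    using that R_fin by (rule mult_divide_eq_ennreal)
  \<comment> \<open>If nothing is missing, both residuals vanish and the added term is 0 / 0 =
    0.\<close>
  define w' where "w' i j = w i j + r i * s j / sum r I" for i j
  have sdiv: "(\<Sum>j\<in>I. g j / sum r I) = (\<Sum>j\<in>I. g j) / sum r I" for g :: "'c \<Rightarrow> ennreal"
    by (simp add: divide_ennreal_def sum_distrib_right)
  have row': "(\<Sum>j\<in>I. w' i j) = emeasure \<alpha> (c -` {i})" if "i \<in> I" for i
  proof -
    have "(\<Sum>j\<in>I. r i * s j / sum r I) = r i * sum r I / sum r I"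
      by (simp add: sdiv sum_distrib_left[symmetric] RS)
    also have "\<dots> = r i" using R0[OF _ that] divR by (cases "sum r I = 0") auto
    finally show ?thesis by (simp add: w'_def sum.distrib r that)
  qed
  have col': "(\<Sum>i\<in>I. w' i j) = emeasure \<beta> (c -` {j})" if "j \<in> I" for j
  proof -
    have "(\<Sum>i\<in>I. r i * s j / sum r I) = s j * sum r I / sum r I"
      by (simp add: sdiv sum_distrib_right[symmetric] mult.commute)
    also have "\<dots> = s j" using R0[OF _ that] divR by (cases "sum r I = 0") auto
    finally show ?thesis by (simp add: w'_def sum.distrib s that)
  qed
  obtain \<upsilon> where \<upsilon>: "\<upsilon> \<in> couplings \<alpha> \<beta>"
    and cost: "\<And>F. (\<integral>\<^sup>+ z. F (c (fst z)) (c (snd z)) \<partial>\<upsilon>) = (\<Sum>i\<in>I. \<Sum>j\<in>I. F i j * w' i j)"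
    using coupling_of_matrix[OF \<alpha> \<beta> c I row' col'] by blast
  have "(\<Sum>i\<in>I. \<Sum>j\<in>I. F i j * (r i * s j / sum r I)) \<le> (\<Sum>i\<in>I. \<Sum>j\<in>I. K * (r i * s j / sum r I))"
    by (intro sum_mono mult_right_mono F) auto
  also have "\<dots> = K * (sum r I * sum r I / sum r I)"
  proof -
    have "(\<Sum>i\<in>I. \<Sum>j\<in>I. r i * s j / sum r I) = sum r I * sum r I / sum r I"
      by (simp add: sdiv sum_product[symmetric] RS)
    then show ?thesis by (simp add: sum_distrib_left[symmetric])
  qed
  also have "\<dots> = K * sum r I" using divR by (cases "sum r I = 0") auto
  also have "\<dots> \<le> K * \<delta>" by (intro mult_left_mono R_le) auto
  finally have "(\<integral>\<^sup>+ z. F (c (fst z)) (c (snd z)) \<partial>\<upsilon>) \<le> (\<Sum>i\<in>I. \<Sum>j\<in>I. F i j * w i j) + K * \<delta>"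
    unfolding cost w'_def by (simp add: distrib_left sum.distrib add_left_mono)
  with \<upsilon> show ?thesis using that by blast
qed

text \<open>
  The cell masses of the near-optimal couplings are rounded down to multiples of \<open>1 / N\<close>; the selected
  matrices are averaged over \<open>\<upsilon>\<close>, and the mass lost by rounding is put back at the end.
\<close>

lemma finite_cost_coupling_bind:
  fixes \<mu> \<nu> :: "'a::second_countable_topology measure" and c :: "'a \<Rightarrow> 'c"
    and F :: "'c \<Rightarrow> 'c \<Rightarrow> ennreal" and K \<epsilon> :: real
  assumes \<mu>: "\<mu> \<in> space (prob_algebra borel)" and \<nu>: "\<nu> \<in> space (prob_algebra borel)"
    and P: "P \<in> borel \<rightarrow>\<^sub>M prob_algebra borel"
    and c [measurable]: "c \<in> borel \<rightarrow>\<^sub>M count_space UNIV" and I: "finite I" "range c \<subseteq> I"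
    and F: "\<And>i j. F i j \<le> ennreal K"
    and g [measurable]: "g \<in> borel_measurable (borel \<Otimes>\<^sub>M borel)"
    and near: "\<And>x y. \<exists>\<gamma>\<in>couplings (P x) (P y). (\<integral>\<^sup>+ z. F (c (fst z)) (c (snd z)) \<partial>\<gamma>) \<le> g (x, y)"
    and \<upsilon>: "\<upsilon> \<in> couplings \<mu> \<nu>" and \<epsilon>: "\<epsilon> > 0"
  shows "\<exists>\<upsilon>'\<in>couplings (\<mu> \<bind> P) (\<nu> \<bind> P).
    (\<integral>\<^sup>+ z. F (c (fst z)) (c (snd z)) \<partial>\<upsilon>') \<le> (\<integral>\<^sup>+ z. g z \<partial>\<upsilon>) + ennreal \<epsilon>"
proof -
  note [measurable] = P
  note \<upsilon>D = couplingsD[OF \<upsilon>]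
  interpret \<upsilon>: prob_space \<upsilon> by (rule \<upsilon>D(1))
  note [measurable_cong] = \<upsilon>D(2)
  define n where "n = real (card I) ^ 2"
  define K' where "K' = max K 0"
  \<comment> \<open>There are \<open>n\<close> matrix entries and each loses at most 1 / N, so the
    completion costs at most K' n / N, which should be at most \<epsilon>.\<close>
  obtain N :: nat where "real N > K' * n / \<epsilon>" using reals_Archimedean2 by blast
  moreover have "K' * n / \<epsilon> \<ge> 0" using \<epsilon> by (auto simp: K'_def n_def)
  ultimately have "real N > 0" "K' * n < real N * \<epsilon>"
    using \<epsilon> by (linarith, simp add: pos_divide_less_eq)
  then have N: "N > 0" "K' * (n / N) \<le> \<epsilon>"
    by (auto simp: divide_le_eq mult.commute)
  \<comment> \<open>The bound \<open>N\<close> on the entries is enough because cell masses are at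
    most 1. Enumerating \<open>Q\<close> by naturals lets a least index be selected later.\<close>
  define Q where "Q = I \<times> I \<rightarrow>\<^sub>E {..N}"
  have Q: "countable Q" "Q \<noteq> {}" unfolding Q_def
    using I by (auto intro!: countable_finite finite_PiE simp: PiE_eq_empty_iff)
  define q where "q l i j = ennreal (real (from_nat_into Q l (i, j)) / real N)" for l i j
  have cs [measurable]: "c -` {i} \<in> sets borel" for i
    using measurable_sets[OF c, of "{i}"] by simp
  \<comment> \<open>Admissibility of the matrix with index \<open>l\<close> at the pair
    \<open>z\<close>. For fixed \<open>l\<close> it consists of finitely many inequalities between
    measurable functions of \<open>z\<close>, whereas a condition quantifying over couplings would
    not be visibly measurable.\<close>
  define D where "D l z \<longleftrightarrow> (\<forall>i\<in>I. (\<Sum>j\<in>I. q l i j) \<le> emeasure (P (fst z)) (c -` {i}))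
     \<and> (\<forall>j\<in>I. (\<Sum>i\<in>I. q l i j) \<le> emeasure (P (snd z)) (c -` {j}))
     \<and> (\<Sum>i\<in>I. \<Sum>j\<in>I. F i j * q l i j) \<le> g z
     \<and> 1 \<le> (\<Sum>i\<in>I. \<Sum>j\<in>I. q l i j) + ennreal (n / N)" for l z
  have em [measurable]: "(\<lambda>x. emeasure (P x) E) \<in> borel_measurable borel" if "E \<in> sets borel" for E
    using measurable_emeasure_kernel[OF measurable_prob_algebraD[OF P] that] .
  have [measurable]: "Measurable.pred (borel \<Otimes>\<^sub>M borel) (D l)" for l
    unfolding D_def using I(1) by measurable
  have ex: "\<exists>l. D l (x, y)" for x y
  proof -
    obtain \<gamma> where \<gamma>: "\<gamma> \<in> couplings (P x) (P y)"
      and cost: "(\<integral>\<^sup>+ z. F (c (fst z)) (c (snd z)) \<partial>\<gamma>) \<le> g (x, y)"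
      using near by blast
    note \<gamma>D = couplingsD[OF \<gamma>]
    interpret \<gamma>: prob_space \<gamma> by (rule \<gamma>D(1))
    define e where "e i j = measure \<gamma> {z. c (fst z) = i \<and> c (snd z) = j}" for i j
    note int = nn_integral_finite_code_pair[OF c I \<gamma>D(2), unfolded \<gamma>.emeasure_eq_measure, folded e_def]
    define \<kappa> where "\<kappa> = restrict (\<lambda>(i, j). nat \<lfloor>N * e i j\<rfloor>) (I \<times> I)"
    have e: "0 \<le> e i j" "e i j \<le> 1" for i j by (auto simp: e_def)
    have \<kappa>: "real (\<kappa> (i, j)) / N \<le> e i j" "e i j \<le> real (\<kappa> (i, j)) / N + 1 / N" if "i \<in> I" "j \<in> I" for i j
    proof -
      have "real (\<kappa> (i, j)) = of_int \<lfloor>N * e i j\<rfloor>" using that e by (simp add: \<kappa>_def)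
      then have "real (\<kappa> (i, j)) \<le> N * e i j" "N * e i j \<le> real (\<kappa> (i, j)) + 1" by linarith+
      then show "real (\<kappa> (i, j)) / N \<le> e i j" "e i j \<le> real (\<kappa> (i, j)) / N + 1 / N"
        using N by (auto simp: field_simps)
    qed
    have "\<kappa> \<in> Q"
      unfolding Q_def
    proof (rule PiE_I)
      fix p assume "p \<in> I \<times> I"
      then obtain i j where p: "p = (i, j)" "i \<in> I" "j \<in> I" by auto
      have "real N * e i j \<le> real N * 1" using e by (intro mult_left_mono) auto
      then show "\<kappa> p \<in> {..N}" using p by (auto simp: \<kappa>_def nat_le_iff floor_le_iff)
    qed (auto simp: \<kappa>_def)
    then obtain l where l: "from_nat_into Q l = \<kappa>"
      using from_nat_into_surj[OF Q(1)] by blast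
    have q_le: "q l i j \<le> ennreal (e i j)" and le_q: "ennreal (e i j) \<le> q l i j + ennreal (1 / N)"
      if "i \<in> I" "j \<in> I" for i j
      using \<kappa>[OF that] by (auto simp: q_def l simp flip: ennreal_plus intro!: ennreal_leI)
    have marg1: "(\<Sum>j\<in>I. ennreal (e i j)) = emeasure (P x) (c -` {i})" if "i \<in> I" for i
    proof -
      have "emeasure (P x) (c -` {i}) = (\<integral>\<^sup>+ u. indicator (c -` {i}) u \<partial>P x)"
        using sets_kernel[OF measurable_prob_algebraD[OF P]] by (intro nn_integral_indicator[symmetric]) simp
      also have "\<dots> = (\<integral>\<^sup>+ z. indicator (c -` {i}) (fst z) \<partial>\<gamma>)"
        by (rule couplings_nn_integral(1)[OF \<gamma>, symmetric]) measurable
      also have "\<dots> = (\<integral>\<^sup>+ z. (if c (fst z) = i then 1 else 0) \<partial>\<gamma>)"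
        by (intro nn_integral_cong) (auto simp: indicator_def)
      also have "\<dots> = (\<Sum>i'\<in>I. \<Sum>j\<in>I. (if i' = i then 1 else 0) * ennreal (e i' j))"
        using int[of "\<lambda>i' j. if i' = i then 1 else 0"] by simp
      also have "\<dots> = (\<Sum>i'\<in>I. if i' = i then \<Sum>j\<in>I. ennreal (e i' j) else 0)"
        by (intro sum.cong) auto
      finally show ?thesis using that I by simp
    qed
    have marg2: "(\<Sum>i\<in>I. ennreal (e i j)) = emeasure (P y) (c -` {j})" if "j \<in> I" for j
    proof -
      have "emeasure (P y) (c -` {j}) = (\<integral>\<^sup>+ u. indicator (c -` {j}) u \<partial>P y)"
        using sets_kernel[OF measurable_prob_algebraD[OF P]] by (intro nn_integral_indicator[symmetric]) simp
      also have "\<dots> = (\<integral>\<^sup>+ z. indicator (c -` {j}) (snd z) \<partial>\<gamma>)"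
        by (rule couplings_nn_integral(2)[OF \<gamma>, symmetric]) measurable
      also have "\<dots> = (\<integral>\<^sup>+ z. (if c (snd z) = j then 1 else 0) \<partial>\<gamma>)"
        by (intro nn_integral_cong) (auto simp: indicator_def)
      also have "\<dots> = (\<Sum>i\<in>I. \<Sum>j'\<in>I. (if j' = j then 1 else 0) * ennreal (e i j'))"
        using int[of "\<lambda>i j'. if j' = j then 1 else 0"] by simp
      also have "\<dots> = (\<Sum>i\<in>I. \<Sum>j'\<in>I. if j' = j then ennreal (e i j') else 0)"
        by (intro sum.cong) auto
      finally show ?thesis using that I by simp
    qed
    have "D l (x, y)" unfolding D_def
    proof (intro conjI ballI)
      show "(\<Sum>j\<in>I. q l i j) \<le> emeasure (P (fst (x, y))) (c -` {i})" if "i \<in> I" for i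
        using marg1[OF that] sum_mono[of I "\<lambda>j. q l i j" "\<lambda>j. ennreal (e i j)"] q_le that by simp
      show "(\<Sum>i\<in>I. q l i j) \<le> emeasure (P (snd (x, y))) (c -` {j})" if "j \<in> I" for j
        using marg2[OF that] sum_mono[of I "\<lambda>i. q l i j" "\<lambda>i. ennreal (e i j)"] q_le that by simp
      have "(\<Sum>i\<in>I. \<Sum>j\<in>I. F i j * q l i j) \<le> (\<Sum>i\<in>I. \<Sum>j\<in>I. F i j * ennreal (e i j))"
        by (intro sum_mono mult_left_mono q_le) auto
      then show "(\<Sum>i\<in>I. \<Sum>j\<in>I. F i j * q l i j) \<le> g (x, y)" using cost unfolding int by simp
      have "1 = (\<Sum>i\<in>I. \<Sum>j\<in>I. ennreal (e i j))"
        using int[of "\<lambda>_ _. 1"] \<gamma>.emeasure_space_1 by simp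
      also have "\<dots> \<le> (\<Sum>i\<in>I. \<Sum>j\<in>I. q l i j + ennreal (1 / N))"
        by (intro sum_mono le_q)
      also have "\<dots> = (\<Sum>i\<in>I. \<Sum>j\<in>I. q l i j) + ennreal (n / N)"
        by (simp add: sum.distrib n_def power2_eq_square ennreal_of_nat_eq_real_of_nat flip: ennreal_mult)
      finally show "1 \<le> (\<Sum>i\<in>I. \<Sum>j\<in>I. q l i j) + ennreal (n / N)" .
    qed
    then show ?thesis ..
  qed
  define sel where "sel z = (LEAST l. D l z)" for z
  have [measurable]: "sel \<in> borel \<Otimes>\<^sub>M borel \<rightarrow>\<^sub>M count_space UNIV"
    unfolding sel_def by measurable
  have sel: "D (sel z) z" for z
    unfolding sel_def using LeastI_ex[OF ex[of "fst z" "snd z"]] by (simp only: prod.collapse)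
  \<comment> \<open>Each clause of \<open>D\<close> is linear in the matrix, so it survives
    averaging; the marginals of \<upsilon> turn the averaged cell masses of \<open>P\<close> into
    those of \<mu>P and \<nu>P.\<close>
  define w where "w i j = (\<integral>\<^sup>+ z. q (sel z) i j \<partial>\<upsilon>)" for i j
  have [measurable]: "(\<lambda>z. q (sel z) i j) \<in> borel_measurable (borel \<Otimes>\<^sub>M borel)" for i j
    by (rule measurable_compose[where N = "count_space UNIV" and f = sel and g = "\<lambda>l. q l i j"])
      simp_all
  have bind1: "emeasure (\<mu> \<bind> P) (c -` {i}) = (\<integral>\<^sup>+ z. emeasure (P (fst z)) (c -` {i}) \<partial>\<upsilon>)" for i
    using couplings_nn_integral(1)[OF \<upsilon> em[OF cs]] by (simp add: emeasure_bind_prob_algebra[OF \<mu> P])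
  have bind2: "emeasure (\<nu> \<bind> P) (c -` {i}) = (\<integral>\<^sup>+ z. emeasure (P (snd z)) (c -` {i}) \<partial>\<upsilon>)" for i
    using couplings_nn_integral(2)[OF \<upsilon> em[OF cs]] by (simp add: emeasure_bind_prob_algebra[OF \<nu> P])
  have \<mu>P: "\<mu> \<bind> P \<in> space (prob_algebra borel)" and \<nu>P: "\<nu> \<bind> P \<in> space (prob_algebra borel)"
    using \<mu> \<nu> P by (auto simp: space_prob_algebra[of borel] prob_space_bind'[OF \<mu> P] prob_space_bind'[OF \<nu> P] sets_bind'[OF \<mu> P] sets_bind'[OF \<nu> P])
  have row: "(\<Sum>j\<in>I. w i j) \<le> emeasure (\<mu> \<bind> P) (c -` {i})" if "i \<in> I" for i
    unfolding bind1 w_def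
    by (subst nn_integral_sum[symmetric]) (use sel that in \<open>auto simp: D_def intro!: nn_integral_mono\<close>)
  have col: "(\<Sum>i\<in>I. w i j) \<le> emeasure (\<nu> \<bind> P) (c -` {j})" if "j \<in> I" for j
    unfolding bind2 w_def
    by (subst nn_integral_sum[symmetric]) (use sel that in \<open>auto simp: D_def intro!: nn_integral_mono\<close>)
  have "1 = (\<integral>\<^sup>+ z. 1 \<partial>\<upsilon>)" by (simp add: \<upsilon>.emeasure_space_1)
  also have "\<dots> \<le> (\<integral>\<^sup>+ z. (\<Sum>i\<in>I. \<Sum>j\<in>I. q (sel z) i j) + ennreal (n / N) \<partial>\<upsilon>)"
    using sel by (intro nn_integral_mono) (auto simp: D_def)
  also have "\<dots> = (\<Sum>i\<in>I. \<Sum>j\<in>I. w i j) + ennreal (n / N)"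
    by (simp add: nn_integral_add nn_integral_sum w_def \<upsilon>.emeasure_space_1)
  finally have total: "1 \<le> (\<Sum>i\<in>I. \<Sum>j\<in>I. w i j) + ennreal (n / N)" .
  have "(\<Sum>i\<in>I. \<Sum>j\<in>I. F i j * w i j) = (\<integral>\<^sup>+ z. (\<Sum>i\<in>I. \<Sum>j\<in>I. F i j * q (sel z) i j) \<partial>\<upsilon>)"
    by (simp add: nn_integral_sum nn_integral_cmult w_def)
  also have "\<dots> \<le> (\<integral>\<^sup>+ z. g z \<partial>\<upsilon>)"
    using sel by (intro nn_integral_mono) (auto simp: D_def)
  finally have cost: "(\<Sum>i\<in>I. \<Sum>j\<in>I. F i j * w i j) \<le> (\<integral>\<^sup>+ z. g z \<partial>\<upsilon>)" .
  obtain \<upsilon>' where \<upsilon>': "\<upsilon>' \<in> couplings (\<mu> \<bind> P) (\<nu> \<bind> P)"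
    "(\<integral>\<^sup>+ z. F (c (fst z)) (c (snd z)) \<partial>\<upsilon>') \<le> (\<Sum>i\<in>I. \<Sum>j\<in>I. F i j * w i j) + ennreal K * ennreal (n / N)"
    by (rule coupling_of_submatrix[OF \<mu>P \<nu>P c I row col total F])
  \<comment> \<open>\<open>ennreal\<close> sends a negative \<open>K\<close> to 0, which is why
    \<open>N\<close> was chosen with \<open>K'\<close>.\<close>
  have "ennreal K = ennreal K'" by (simp add: K'_def max_def ennreal_neg)
  then have "ennreal K * ennreal (n / N) = ennreal (K' * (n / N))"
    using ennreal_mult''[of "n / N" K'] by (simp add: n_def)
  also have "\<dots> \<le> ennreal \<epsilon>" by (intro ennreal_leI N)
  finally have "(\<integral>\<^sup>+ z. F (c (fst z)) (c (snd z)) \<partial>\<upsilon>') \<le> (\<integral>\<^sup>+ z. g z \<partial>\<upsilon>) + ennreal \<epsilon>"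
    using \<upsilon>'(2) cost by (meson add_mono order_trans)
  with \<upsilon>'(1) show ?thesis by blast
qed

section \<open>Integrating bounds on the Wasserstein divergence\<close>

text \<open>The fibres are the cells of the partition generated by the first \<open>k\<close> sets;
  they refine as \<open>k\<close> grows.\<close>

definition prefix_code :: "(nat \<Rightarrow> 'a set) \<Rightarrow> nat \<Rightarrow> 'a \<Rightarrow> bool list" where
  "prefix_code C k x = map (\<lambda>i. x \<in> C i) [0..<k]"

lemma measurable_prefix_code [measurable]:
  assumes "\<And>i. C i \<in> sets M"
  shows "prefix_code C k \<in> M \<rightarrow>\<^sub>M count_space UNIV"
  unfolding prefix_code_def
  by (rule measurable_compose[OF measurable_code[OF assms] measurable_bits_prefix])

lemma range_prefix_code: "range (prefix_code C k) \<subseteq> {l. length l = k}"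
  by (auto simp: prefix_code_def)

lemma finite_bool_lists: "finite {l :: bool list. length l = k}"
  using finite_lists_length_eq[of "UNIV :: bool set" k] by simp

lemma prefix_code_eqD:
  assumes "prefix_code C k x = prefix_code C k u" "i < k"
  shows "x \<in> C i \<longleftrightarrow> u \<in> C i"
  using assms by (auto simp: prefix_code_def)

text \<open>The two codes of a pair are interleaved into one bit sequence and a limit is taken
  there. Each half of the limit has the law of the codes under \<alpha> or \<beta>, so almost every
  sequence decodes to a pair of points.\<close>

lemma couplings_seq_compact:
  fixes C :: "nat \<Rightarrow> 'a::polish_space set" and \<upsilon> :: "nat \<Rightarrow> ('a \<times> 'a) measure"
  assumes small: "\<And>x e. e > 0 \<Longrightarrow> \<exists>i. x \<in> C i \<and> (\<forall>u\<in>C i. \<forall>v\<in>C i. dist u v < e)"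
    and C [measurable]: "\<And>i. C i \<in> sets borel"
    and \<upsilon>: "\<And>n. \<upsilon> n \<in> couplings \<alpha> \<beta>"
  obtains s \<Theta> where "strict_mono s" "\<Theta> \<in> couplings \<alpha> \<beta>"
    "\<And>k F. (\<integral>\<^sup>+ z. F (prefix_code C k (fst z)) (prefix_code C k (snd z)) \<partial>\<Theta>)
       \<le> liminf (\<lambda>n. \<integral>\<^sup>+ z. (F (prefix_code C k (fst z)) (prefix_code C k (snd z)) :: ennreal) \<partial>\<upsilon> (s n))"
proof -
  note \<upsilon>D = couplingsD[OF \<upsilon>]
  note [measurable_cong] = \<upsilon>D(2)
  obtain \<pi> where \<pi> [measurable]: "\<pi> \<in> bits \<rightarrow>\<^sub>M borel" and \<pi>_code: "\<And>x. \<pi> (\<lambda>i. x \<in> C i) = x"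
    using code_left_inverse[of C, OF small] by blast
  \<comment> \<open>With even and odd positions, the first \<open>k\<close> bits of both codes lie
    among the first \<open>2 * k\<close> bits.\<close>
  define join where "join z = (\<lambda>i. if even i then fst z \<in> C (i div 2) else snd z \<in> C (i div 2))"
    for z :: "'a \<times> 'a"
  have [measurable]: "join \<in> borel \<Otimes>\<^sub>M borel \<rightarrow>\<^sub>M bits"
    unfolding join_def by (rule measurable_PiM_single') auto
  define ev od where "ev b = (\<lambda>i. b (2 * i))" and "od b = (\<lambda>i. b (2 * i + 1))" for b :: "nat \<Rightarrow> bool"
  have ev_od [measurable]: "ev \<in> bits \<rightarrow>\<^sub>M bits" "od \<in> bits \<rightarrow>\<^sub>M bits"
    unfolding ev_def od_def by (rule measurable_PiM_single'; simp)+
  have ev_join: "ev (join z) = (\<lambda>i. fst z \<in> C i)" and od_join: "od (join z) = (\<lambda>i. snd z \<in> C i)" for z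
    by (auto simp: ev_def od_def join_def)
  have dep: "depends_on_first (2 * k) (\<lambda>b. F (ev b))" "depends_on_first (2 * k) (\<lambda>b. F (od b))"
    if "depends_on_first k F" for k and F :: "_ \<Rightarrow> ennreal"
    using that by (auto simp: depends_on_first_def ev_def od_def)
  define N where "N n = distr (\<upsilon> n) bits join" for n
  have "N n \<in> space (prob_algebra bits)" for n
    unfolding N_def space_prob_algebra by (auto intro!: prob_space.prob_space_distr \<upsilon>D(1))
  then obtain s M where s: "strict_mono s" and M: "M \<in> space (prob_algebra bits)"
    and fatou: "\<And>k F. depends_on_first k F \<Longrightarrow>
       (\<integral>\<^sup>+ b. F b \<partial>M) \<le> liminf (\<lambda>n. \<integral>\<^sup>+ b. (F b :: ennreal) \<partial>N (s n))"
    using prob_bits_seq_compact[of N] by blast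
  have [measurable_cong]: "sets M = sets bits" and "prob_space M"
    using M by (auto simp: space_prob_algebra)
  interpret M: prob_space M by fact
  have int_N: "(\<integral>\<^sup>+ b. F b \<partial>N n) = (\<integral>\<^sup>+ z. F (join z) \<partial>\<upsilon> n)"
    if "F \<in> borel_measurable bits" for n and F :: "_ \<Rightarrow> ennreal"
    unfolding N_def using that by (intro nn_integral_distr) auto
  \<comment> \<open>All the \<upsilon> n have the same marginal, so the liminf is that of a constant
    sequence and \<open>prob_bits_eqI\<close> identifies the law. One argument covers both
    coordinates.\<close>
  have law: "distr M bits f = distr \<gamma> bits (\<lambda>x i. x \<in> C i)"
    if f [measurable]: "f \<in> bits \<rightarrow>\<^sub>M bits"
      and p [measurable]: "p \<in> borel \<Otimes>\<^sub>M borel \<rightarrow>\<^sub>M borel"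
      and join: "\<And>z. f (join z) = (\<lambda>i. p z \<in> C i)"
      and dep: "\<And>k (F :: _ \<Rightarrow> ennreal). depends_on_first k F \<Longrightarrow> depends_on_first (2 * k) (\<lambda>b. F (f b))"
      and \<gamma>: "\<And>n. distr (\<upsilon> n) borel p = \<gamma>"
    for f and p :: "'a \<times> 'a \<Rightarrow> 'a" and \<gamma>
  proof (rule prob_bits_eqI)
    have [measurable_cong]: "sets \<gamma> = sets borel" using \<gamma>[of 0, symmetric] by simp
    have "prob_space \<gamma>"
      unfolding \<gamma>[of 0, symmetric] by (rule prob_space.prob_space_distr[OF \<upsilon>D(1)]) measurable
    then show "distr \<gamma> bits (\<lambda>x i. x \<in> C i) \<in> space (prob_algebra bits)"
      unfolding space_prob_algebra by (auto intro!: prob_space.prob_space_distr)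
    show "distr M bits f \<in> space (prob_algebra bits)"
      unfolding space_prob_algebra by (auto intro!: M.prob_space_distr)
    fix k and F :: "(nat \<Rightarrow> bool) \<Rightarrow> ennreal" assume F: "depends_on_first k F"
    have [measurable]: "F \<in> borel_measurable bits" by (rule depends_on_first_measurable[OF F]) simp
    have "(\<integral>\<^sup>+ b. F b \<partial>distr M bits f) = (\<integral>\<^sup>+ b. F (f b) \<partial>M)"
      by (rule nn_integral_distr) auto
    also have "\<dots> \<le> liminf (\<lambda>n. \<integral>\<^sup>+ b. F (f b) \<partial>N (s n))" by (rule fatou[OF dep[OF F]])
    also have "(\<lambda>n. \<integral>\<^sup>+ b. F (f b) \<partial>N (s n)) = (\<lambda>n. \<integral>\<^sup>+ x. F (\<lambda>i. x \<in> C i) \<partial>\<gamma>)"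
    proof
      fix n
      have "(\<integral>\<^sup>+ b. F (f b) \<partial>N (s n)) = (\<integral>\<^sup>+ z. F (\<lambda>i. p z \<in> C i) \<partial>\<upsilon> (s n))"
        by (simp add: int_N join)
      also have "\<dots> = (\<integral>\<^sup>+ x. F (\<lambda>i. x \<in> C i) \<partial>distr (\<upsilon> (s n)) borel p)"
        by (rule nn_integral_distr[symmetric]) auto
      finally show "(\<integral>\<^sup>+ b. F (f b) \<partial>N (s n)) = (\<integral>\<^sup>+ x. F (\<lambda>i. x \<in> C i) \<partial>\<gamma>)" by (simp add: \<gamma>)
    qed
    also have "(\<integral>\<^sup>+ x. F (\<lambda>i. x \<in> C i) \<partial>\<gamma>) = (\<integral>\<^sup>+ b. F b \<partial>distr \<gamma> bits (\<lambda>x i. x \<in> C i))"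
      by (rule nn_integral_distr[symmetric]) auto
    finally show "(\<integral>\<^sup>+ b. F b \<partial>distr M bits f) \<le> (\<integral>\<^sup>+ b. F b \<partial>distr \<gamma> bits (\<lambda>x i. x \<in> C i))"
      by (simp add: Liminf_const)
  qed
  have marg: "distr M borel (\<lambda>b. \<pi> (f b)) = \<gamma>" and AE_code: "AE b in M. (\<lambda>i. \<pi> (f b) \<in> C i) = f b"
    if f [measurable]: "f \<in> bits \<rightarrow>\<^sub>M bits" and law: "distr M bits f = distr \<gamma> bits (\<lambda>x i. x \<in> C i)"
      and [measurable_cong]: "sets \<gamma> = sets borel"
    for f and \<gamma> :: "'a measure"
  proof -
    have "distr M borel (\<lambda>b. \<pi> (f b)) = distr (distr M bits f) borel \<pi>"
      by (subst distr_distr) (auto simp: comp_def)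
    also have "\<dots> = distr \<gamma> borel (\<lambda>x. x)"
      unfolding law by (subst distr_distr) (auto simp: comp_def \<pi>_code)
    also have "\<dots> = \<gamma>" by (rule distr_id2) (use that in simp)
    finally show "distr M borel (\<lambda>b. \<pi> (f b)) = \<gamma>" .
    have pred: "{b \<in> space bits. (\<lambda>i. \<pi> b \<in> C i) = b} \<in> sets bits"
      unfolding fun_eq_iff by measurable
    \<comment> \<open>Decoding and coding again is the identity on genuine codes, and this law is
      carried by them.\<close>
    have "AE b in distr \<gamma> bits (\<lambda>x i. x \<in> C i). (\<lambda>i. \<pi> b \<in> C i) = b"
      by (subst AE_distr_iff[OF _ pred]) (auto simp: \<pi>_code)
    then have "AE b in distr M bits f. (\<lambda>i. \<pi> b \<in> C i) = b" by (simp only: law)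
    then show "AE b in M. (\<lambda>i. \<pi> (f b) \<in> C i) = f b"
      by (subst (asm) AE_distr_iff[OF _ pred]) auto
  qed
  have sets_\<alpha>\<beta>: "sets \<alpha> = sets borel" "sets \<beta> = sets borel"
    using \<upsilon>D(3,4)[of 0] by (metis sets_distr)+
  have law_ev: "distr M bits ev = distr \<alpha> bits (\<lambda>x i. x \<in> C i)"
    by (rule law[of ev fst \<alpha>]) (use dep ev_join \<upsilon>D(3) in auto)
  have law_od: "distr M bits od = distr \<beta> bits (\<lambda>x i. x \<in> C i)"
    by (rule law[of od snd \<beta>]) (use dep od_join \<upsilon>D(4) in auto)
  define \<Theta> where "\<Theta> = distr M (borel \<Otimes>\<^sub>M borel) (\<lambda>b. (\<pi> (ev b), \<pi> (od b)))"
  have "distr \<Theta> borel fst = distr M borel (\<lambda>b. \<pi> (ev b))"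
    "distr \<Theta> borel snd = distr M borel (\<lambda>b. \<pi> (od b))"
    unfolding \<Theta>_def by (subst distr_distr; simp add: comp_def)+
  then have "distr \<Theta> borel fst = \<alpha>" "distr \<Theta> borel snd = \<beta>"
    using marg[OF ev_od(1) law_ev sets_\<alpha>\<beta>(1)] marg[OF ev_od(2) law_od sets_\<alpha>\<beta>(2)] by simp_all
  then have \<Theta>: "\<Theta> \<in> couplings \<alpha> \<beta>"
    unfolding couplings_def space_prob_algebra by (auto simp: \<Theta>_def intro!: M.prob_space_distr)
  have "(\<integral>\<^sup>+ z. F (prefix_code C k (fst z)) (prefix_code C k (snd z)) \<partial>\<Theta>)
       \<le> liminf (\<lambda>n. \<integral>\<^sup>+ z. F (prefix_code C k (fst z)) (prefix_code C k (snd z)) \<partial>\<upsilon> (s n))"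
    for k and F :: "bool list \<Rightarrow> bool list \<Rightarrow> ennreal"
  proof -
    note [measurable] = measurable_finite_code_pair[OF measurable_prefix_code[OF C] finite_bool_lists range_prefix_code]
    \<comment> \<open>Reading the bits directly, without decoding, gives a function of finitely many
      bits, to which \<open>fatou\<close> applies.\<close>
    define H where "H b = F (map (ev b) [0..<k]) (map (od b) [0..<k])" for b
    have H: "depends_on_first (2 * k) H"
      by (auto simp: depends_on_first_def H_def ev_def od_def intro!: arg_cong2[where f = F])
    have "(\<integral>\<^sup>+ z. F (prefix_code C k (fst z)) (prefix_code C k (snd z)) \<partial>\<Theta>)
        = (\<integral>\<^sup>+ b. F (prefix_code C k (\<pi> (ev b))) (prefix_code C k (\<pi> (od b))) \<partial>M)"
      unfolding \<Theta>_def by (subst nn_integral_distr) auto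
    also have "\<dots> = (\<integral>\<^sup>+ b. H b \<partial>M)"
    proof (rule nn_integral_cong_AE)
      show "AE b in M. F (prefix_code C k (\<pi> (ev b))) (prefix_code C k (\<pi> (od b))) = H b"
        using AE_code[OF ev_od(1) law_ev sets_\<alpha>\<beta>(1)] AE_code[OF ev_od(2) law_od sets_\<alpha>\<beta>(2)]
        by eventually_elim (simp add: prefix_code_def H_def)
    qed
    also have "\<dots> \<le> liminf (\<lambda>n. \<integral>\<^sup>+ b. H b \<partial>N (s n))" by (rule fatou[OF H])
    also have "(\<lambda>n. \<integral>\<^sup>+ b. H b \<partial>N (s n))
        = (\<lambda>n. \<integral>\<^sup>+ z. F (prefix_code C k (fst z)) (prefix_code C k (snd z)) \<partial>\<upsilon> (s n))"
      using depends_on_first_measurable[OF H]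
      by (simp add: int_N H_def ev_join od_join prefix_code_def)
    finally show ?thesis .
  qed
  with s \<Theta> show ?thesis using that by blast
qed

text \<open>The hypothesis \<open>lsc\<close> is lower semicontinuity with a countable family of
  Borel sets in place of the open sets. Cell-constant costs \<open>H k\<close> increase to
  \<open>h\<close>. Couplings that are good for \<open>H k\<close> subconverge, and their limit is
  good for every \<open>H k\<close>, hence for \<open>h\<close> by monotone convergence.\<close>

lemma wasserstein_bind_le:
  fixes h :: "'a::polish_space \<times> 'a \<Rightarrow> real" and P :: "'a \<Rightarrow> 'a measure"
  assumes \<mu>: "\<mu> \<in> space (prob_algebra borel)" and \<nu>: "\<nu> \<in> space (prob_algebra borel)"
    and P: "P \<in> borel \<rightarrow>\<^sub>M prob_algebra borel"
    and \<C>: "countable \<C>" "\<C> \<subseteq> sets borel"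
    and lsc: "\<And>x y c. c < h (x, y) \<Longrightarrow> \<exists>A\<in>\<C>. \<exists>B\<in>\<C>. x \<in> A \<and> y \<in> B \<and> (\<forall>u\<in>A. \<forall>v\<in>B. c < h (u, v))"
    and g [measurable]: "g \<in> borel_measurable (borel \<Otimes>\<^sub>M borel)"
    and le: "\<And>x y. wasserstein h (P x) (P y) \<le> g (x, y)"
    and \<upsilon>: "\<upsilon> \<in> couplings \<mu> \<nu>"
  shows "wasserstein h (\<mu> \<bind> P) (\<nu> \<bind> P) \<le> (\<integral>\<^sup>+ z. g z \<partial>\<upsilon>)"
proof -
  interpret \<upsilon>: prob_space \<upsilon> by (rule couplingsD(1)[OF \<upsilon>])
  note [measurable_cong] = couplingsD(2)[OF \<upsilon>]
  obtain \<B> :: "'a set set" where \<B>: "countable \<B>" "topological_basis \<B>"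
    using ex_countable_basis by blast
  \<comment> \<open>The topological basis is added so that the cells shrink to points and codes can
    be decoded.\<close>
  define C where "C = from_nat_into (\<C> \<union> \<B>)"
  have "\<B> \<noteq> {}" using topological_basisE[OF \<B>(2) open_UNIV UNIV_I[of undefined]] by blast
  then have C_range: "range C = \<C> \<union> \<B>"
    unfolding C_def using \<C>(1) \<B>(1) by (intro range_from_nat_into) auto
  have "A \<in> sets borel" if "A \<in> \<C> \<union> \<B>" for A
    using that \<C>(2) topological_basis_open[OF \<B>(2)] by auto
  then have C [measurable]: "C i \<in> sets borel" for i
    using C_range by blast
  have small: "\<exists>i. x \<in> C i \<and> (\<forall>u\<in>C i. \<forall>v\<in>C i. dist u v < e)" if "e > 0" for x e
  proof -
    have "x \<in> ball x (e / 2)" using that by simp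
    then obtain B where B: "B \<in> \<B>" "x \<in> B" "B \<subseteq> ball x (e / 2)"
      using topological_basisE[OF \<B>(2) open_ball] by blast
    have "dist u v < e" if "u \<in> B" "v \<in> B" for u v
    proof -
      have "dist x u < e / 2" "dist x v < e / 2" using B(3) that by auto
      then show ?thesis by (rule dist_triangle_half_r)
    qed
    then show ?thesis using B C_range by (metis UnI2 rangeE)
  qed
  \<comment> \<open>The infimum over a cell gives the largest minorant constant on cells. Truncation
    at \<open>k\<close> bounds it, as rounding requires, and also replaces the infimum \<top> of an
    empty cell.\<close>
  define F where "F k l l' = min (of_nat k)
    (INF z\<in>{z. prefix_code C k (fst z) = l \<and> prefix_code C k (snd z) = l'}. ennreal (h z))"
    for k l l'
  define H where "H k z = F k (prefix_code C k (fst z)) (prefix_code C k (snd z))" for k z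
  have [measurable]: "H k \<in> borel_measurable (borel \<Otimes>\<^sub>M borel)" for k
    unfolding H_def
    by (rule measurable_finite_code_pair[OF measurable_prefix_code[OF C] finite_bool_lists range_prefix_code])
  have H_le: "H k z \<le> ennreal (h z)" for k z
    unfolding H_def F_def by (rule min.coboundedI2) (auto intro: INF_lower)
  have H_mono: "incseq (\<lambda>k. H k z)" for z
  proof (rule incseq_SucI)
    fix k
    have Suc: "prefix_code C k x = prefix_code C k u" if "prefix_code C (Suc k) x = prefix_code C (Suc k) u" for x u
      using that by (simp add: prefix_code_def)
    show "H k z \<le> H (Suc k) z"
      unfolding H_def F_def
    proof (intro min.mono INF_superset_mono)
      show "(of_nat k :: ennreal) \<le> of_nat (Suc k)" by (intro of_nat_mono) simp
    qed (use Suc in blast)+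
  qed
  have H_SUP: "(SUP k. H k z) = ennreal (h z)" for z
  proof (rule antisym)
    show "(SUP k. H k z) \<le> ennreal (h z)" by (intro SUP_least H_le)
    show "ennreal (h z) \<le> (SUP k. H k z)"
    proof (rule dense_le)
      fix t assume t: "t < ennreal (h z)"
      then have "t \<noteq> \<top>" by auto
      then obtain c where c: "t = ennreal c" "0 \<le> c" by (cases t) auto
      with t have "c < h (fst z, snd z)" by (simp add: ennreal_less_iff)
      from lsc[OF this] obtain i j where ij: "fst z \<in> C i" "snd z \<in> C j"
        and gt: "\<And>u v. u \<in> C i \<Longrightarrow> v \<in> C j \<Longrightarrow> c < h (u, v)"
        using C_range by (metis UnI1 rangeE)
      obtain n :: nat where n: "c < real n" using reals_Archimedean2 by blast
      \<comment> \<open>From this \<open>k\<close> on, the cells resolve both \<open>C i\<close> and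
        \<open>C j\<close>, and the truncation lies above \<open>c\<close>.\<close>
      define k where "k = Suc i + Suc j + n"
      have k: "i < k" "j < k" "c \<le> real k" using n by (auto simp: k_def)
      have "ennreal c \<le> of_nat k"
        using k(3) by (simp add: ennreal_of_nat_eq_real_of_nat ennreal_leI)
      moreover have "ennreal c \<le> ennreal (h w)"
        if "prefix_code C k (fst w) = prefix_code C k (fst z)" "prefix_code C k (snd w) = prefix_code C k (snd z)" for w
      proof -
        have "fst w \<in> C i" "snd w \<in> C j"
          using prefix_code_eqD[OF that(1) k(1)] prefix_code_eqD[OF that(2) k(2)] ij by auto
        from gt[OF this] show ?thesis by (intro ennreal_leI) simp
      qed
      ultimately have "t \<le> H k z" unfolding H_def F_def c(1) by (auto intro!: INF_greatest)
      then show "t \<le> (SUP k. H k z)" by (rule order_trans) (intro SUP_upper UNIV_I)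
    qed
  qed
  \<comment> \<open>One 1 / Suc k pays for a coupling that only nearly attains the infimum, the
    other for rounding.\<close>
  have "\<exists>\<Upsilon>\<in>couplings (\<mu> \<bind> P) (\<nu> \<bind> P). (\<integral>\<^sup>+ z. H k z \<partial>\<Upsilon>) \<le> (\<integral>\<^sup>+ z. g z \<partial>\<upsilon>) + ennreal (2 / Suc k)" for k
  proof -
    let ?e = "1 / real (Suc k)"
    have F_le: "F k i j \<le> ennreal (real k)" for i j
      unfolding F_def by (simp add: ennreal_of_nat_eq_real_of_nat)
    have near: "\<exists>\<gamma>\<in>couplings (P x) (P y). (\<integral>\<^sup>+ z. H k z \<partial>\<gamma>) \<le> g (x, y) + ennreal ?e" for x y
    \<comment> \<open>At \<top> adding a positive error gives no strict inequality, but then any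
      coupling will do.\<close>
    proof (cases "g (x, y) = \<top>")
      case True
      have "P x \<in> space (prob_algebra borel)" for x by (rule measurable_space[OF P]) simp
      then show ?thesis using True pair_measure_in_couplings by (intro bexI[of _ "P x \<Otimes>\<^sub>M P y"]) auto
    next
      case False
      then have "g (x, y) < g (x, y) + ennreal ?e"
        by (cases "g (x, y)") (auto simp: ennreal_less_iff simp flip: ennreal_plus)
      with le[of x y] have "wasserstein h (P x) (P y) < g (x, y) + ennreal ?e" by (rule le_less_trans)
      then obtain \<gamma> where \<gamma>: "\<gamma> \<in> couplings (P x) (P y)"
        and "(\<integral>\<^sup>+ z. ennreal (h z) \<partial>\<gamma>) < g (x, y) + ennreal ?e"
        unfolding wasserstein_def INF_less_iff by blast
      moreover have "(\<integral>\<^sup>+ z. H k z \<partial>\<gamma>) \<le> (\<integral>\<^sup>+ z. ennreal (h z) \<partial>\<gamma>)"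
        by (intro nn_integral_mono H_le)
      ultimately show ?thesis by (intro bexI[OF _ \<gamma>]) simp
    qed
    have "\<exists>\<Upsilon>\<in>couplings (\<mu> \<bind> P) (\<nu> \<bind> P). (\<integral>\<^sup>+ z. H k z \<partial>\<Upsilon>) \<le> (\<integral>\<^sup>+ z. g z + ennreal ?e \<partial>\<upsilon>) + ennreal ?e"
      unfolding H_def
    proof (rule finite_cost_coupling_bind[where c = "prefix_code C k" and F = "F k" and K = "real k"])
      show "range (prefix_code C k) \<subseteq> {l. length l = k}" by (rule range_prefix_code)
      show "\<exists>\<gamma>\<in>couplings (P x) (P y). (\<integral>\<^sup>+ z. F k (prefix_code C k (fst z)) (prefix_code C k (snd z)) \<partial>\<gamma>)
          \<le> g (x, y) + ennreal ?e" for x y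
        using near unfolding H_def .
    qed (auto simp: \<mu> \<nu> P \<upsilon> finite_bool_lists F_le)
    moreover have "(\<integral>\<^sup>+ z. g z + ennreal ?e \<partial>\<upsilon>) + ennreal ?e = (\<integral>\<^sup>+ z. g z \<partial>\<upsilon>) + ennreal (2 / Suc k)"
    proof -
      have "ennreal ?e + ennreal ?e = ennreal (2 / Suc k)" by (simp flip: ennreal_plus)
      then show ?thesis by (simp add: nn_integral_add \<upsilon>.emeasure_space_1 add.assoc)
    qed
    ultimately show ?thesis by simp
  qed
  then obtain \<Upsilon> where \<Upsilon>: "\<And>k. \<Upsilon> k \<in> couplings (\<mu> \<bind> P) (\<nu> \<bind> P)"
    and cost: "\<And>k. (\<integral>\<^sup>+ z. H k z \<partial>\<Upsilon> k) \<le> (\<integral>\<^sup>+ z. g z \<partial>\<upsilon>) + ennreal (2 / Suc k)"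
    by metis
  obtain s \<Theta> where s: "strict_mono s" and \<Theta>: "\<Theta> \<in> couplings (\<mu> \<bind> P) (\<nu> \<bind> P)"
    and fatou: "\<And>k. (\<integral>\<^sup>+ z. H k z \<partial>\<Theta>) \<le> liminf (\<lambda>n. \<integral>\<^sup>+ z. H k z \<partial>\<Upsilon> (s n))"
    unfolding H_def by (rule couplings_seq_compact[of C \<Upsilon>, OF small C \<Upsilon>]) blast+
  note [measurable_cong] = couplingsD(2)[OF \<Theta>]
  have "(\<integral>\<^sup>+ z. H k z \<partial>\<Theta>) \<le> (\<integral>\<^sup>+ z. g z \<partial>\<upsilon>)" for k
  proof (rule ennreal_le_epsilon)
    fix e :: real assume e: "e > 0"
    obtain m where m: "2 / e < real m" using reals_Archimedean2 by blast
    have ev: "\<forall>\<^sub>F n in sequentially. (\<integral>\<^sup>+ z. H k z \<partial>\<Upsilon> (s n)) \<le> (\<integral>\<^sup>+ z. g z \<partial>\<upsilon>) + ennreal e"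
    proof (rule eventually_sequentiallyI[of "max k m"])
      fix n assume n: "max k m \<le> n"
      have sn: "n \<le> s n" by (rule seq_suble[OF s])
      \<comment> \<open>Diagonal comparison: \<Upsilon> (s n) was chosen for the finer cost
        \<open>H (s n)\<close>, which dominates \<open>H k\<close> once n \<ge> k.\<close>
      have "(\<integral>\<^sup>+ z. H k z \<partial>\<Upsilon> (s n)) \<le> (\<integral>\<^sup>+ z. H (s n) z \<partial>\<Upsilon> (s n))"
        using n sn by (intro nn_integral_mono incseqD[OF H_mono]) simp
      also have "\<dots> \<le> (\<integral>\<^sup>+ z. g z \<partial>\<upsilon>) + ennreal (2 / Suc (s n))" by (rule cost)
      also have "2 / real (Suc (s n)) \<le> e"
      proof -
        have "2 / e < Suc (s n)" using m n sn by simp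
        then show ?thesis using e by (simp add: field_simps)
      qed
      finally show "(\<integral>\<^sup>+ z. H k z \<partial>\<Upsilon> (s n)) \<le> (\<integral>\<^sup>+ z. g z \<partial>\<upsilon>) + ennreal e"
        by (simp add: add_left_mono ennreal_leI)
    qed
    have "liminf (\<lambda>n. \<integral>\<^sup>+ z. H k z \<partial>\<Upsilon> (s n)) \<le> liminf (\<lambda>n. (\<integral>\<^sup>+ z. g z \<partial>\<upsilon>) + ennreal e)"
      by (rule Liminf_mono[OF ev])
    with fatou[of k] show "(\<integral>\<^sup>+ z. H k z \<partial>\<Theta>) \<le> (\<integral>\<^sup>+ z. g z \<partial>\<upsilon>) + ennreal e"
      by (simp add: Liminf_const)
  qed
  then have "(SUP k. \<integral>\<^sup>+ z. H k z \<partial>\<Theta>) \<le> (\<integral>\<^sup>+ z. g z \<partial>\<upsilon>)" by (rule SUP_least)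
  also have "(SUP k. \<integral>\<^sup>+ z. H k z \<partial>\<Theta>) = (\<integral>\<^sup>+ z. (SUP k. H k z) \<partial>\<Theta>)"
    by (rule nn_integral_monotone_convergence_SUP[symmetric])
      (use H_mono in \<open>auto simp: incseq_def le_fun_def\<close>)
  finally have "(\<integral>\<^sup>+ z. ennreal (h z) \<partial>\<Theta>) \<le> (\<integral>\<^sup>+ z. g z \<partial>\<upsilon>)" by (simp add: H_SUP)
  with \<Theta> show ?thesis unfolding wasserstein_def by (rule INF_lower2)
qed

section \<open>The interpolated cost\<close>

text \<open>Hoelder's inequality from Young's: after normalising by \<open>s\<close> and
  \<open>t\<close> the product lies below a linear combination of \<open>f\<close> and
  \<open>u\<close>, and integrating that combination gives exactly the constant.\<close>

lemma nn_integral_powr_mult_le: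
  fixes f u :: "'a \<Rightarrow> real"
  assumes [measurable]: "f \<in> borel_measurable M" "u \<in> borel_measurable M"
    and nonneg: "\<And>x. 0 \<le> f x" "\<And>x. 0 \<le> u x"
    and r: "0 < r" "r < 1" and st: "0 < s" "0 < t"
    and le: "(\<integral>\<^sup>+ x. ennreal (f x) \<partial>M) \<le> ennreal s" "(\<integral>\<^sup>+ x. ennreal (u x) \<partial>M) \<le> ennreal t"
  shows "(\<integral>\<^sup>+ x. ennreal (f x powr r * u x powr (1 - r)) \<partial>M) \<le> ennreal (s powr r * t powr (1 - r))"
proof -
  let ?c = "s powr r * t powr (1 - r)"
  have pt: "f x powr r * u x powr (1 - r) \<le> ?c * r / s * f x + ?c * (1 - r) / t * u x" for x
  proof (cases "f x = 0 \<or> u x = 0")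
    case True
    then show ?thesis using r st nonneg[of x] by auto
  next
    case False
    then have pos: "f x > 0" "u x > 0" using nonneg[of x] by (auto simp: less_le)
    have "(f x / s) powr r * (u x / t) powr (1 - r) \<le> r * (f x / s) + (1 - r) * (u x / t)"
      using r st pos by (intro Youngs_inequality_0) auto
    then have "?c * ((f x / s) powr r * (u x / t) powr (1 - r)) \<le> ?c * (r * (f x / s) + (1 - r) * (u x / t))"
      by (intro mult_left_mono) auto
    moreover have "?c * ((f x / s) powr r * (u x / t) powr (1 - r)) = f x powr r * u x powr (1 - r)"
      using st pos by (simp add: powr_divide)
    ultimately show ?thesis by (simp add: algebra_simps)
  qed
  have "(\<integral>\<^sup>+ x. ennreal (f x powr r * u x powr (1 - r)) \<partial>M)
      \<le> (\<integral>\<^sup>+ x. ennreal (?c * r / s) * ennreal (f x) + ennreal (?c * (1 - r) / t) * ennreal (u x) \<partial>M)"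
    using r st nonneg pt
    by (intro nn_integral_mono) (simp add: ennreal_leI flip: ennreal_mult ennreal_plus)
  also have "\<dots> = ennreal (?c * r / s) * (\<integral>\<^sup>+ x. ennreal (f x) \<partial>M) + ennreal (?c * (1 - r) / t) * (\<integral>\<^sup>+ x. ennreal (u x) \<partial>M)"
    by (simp add: nn_integral_add nn_integral_cmult)
  also have "\<dots> \<le> ennreal (?c * r / s) * ennreal s + ennreal (?c * (1 - r) / t) * ennreal t"
    by (intro add_mono mult_left_mono le) auto
  also have "\<dots> = ennreal ?c"
  proof -
    have "?c * r / s * s + ?c * (1 - r) / t * t = ?c" using st
      by (simp flip: distrib_left add: right_diff_distrib)
    then show ?thesis using r st by (simp flip: ennreal_mult ennreal_plus)
  qed
  finally show ?thesis .
qed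

section \<open>Semicontinuity expressed by rectangles\<close>

lemma lower_semicontinuous_rectangle:
  fixes f :: "'a::topological_space \<times> 'a \<Rightarrow> real"
  assumes f: "lower_semicontinuous f" and \<B>: "topological_basis \<B>" and c: "c < f (x, y)"
  obtains A B where "A \<in> \<B>" "B \<in> \<B>" "x \<in> A" "y \<in> B" "\<And>u v. u \<in> A \<Longrightarrow> v \<in> B \<Longrightarrow> c < f (u, v)"
proof -
  from f c have "\<forall>\<^sub>F z in nhds (x, y). c < f z" by (auto simp: lower_semicontinuous_def)
  then obtain S where S: "open S" "(x, y) \<in> S" "\<And>z. z \<in> S \<Longrightarrow> c < f z"
    unfolding eventually_nhds by blast
  from open_prod_elim[OF S(1,2)] obtain A B where AB: "open A" "open B" "(x, y) \<in> A \<times> B" "A \<times> B \<subseteq> S"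
    by blast
  obtain A' where A': "A' \<in> \<B>" "x \<in> A'" "A' \<subseteq> A"
    using topological_basisE[OF \<B> AB(1)] AB(3) by blast
  obtain B' where B': "B' \<in> \<B>" "y \<in> B'" "B' \<subseteq> B"
    using topological_basisE[OF \<B> AB(2)] AB(3) by blast
  show ?thesis by (rule that[OF A'(1) B'(1) A'(2) B'(2)]) (use S(3) AB(4) A'(3) B'(3) in blast)
qed

text \<open>Every superlevel set is a countable union of rectangles, hence lies in the product
  \<sigma>-algebra itself.\<close>

lemma borel_measurable_rectangles:
  fixes h :: "'a::topological_space \<times> 'a \<Rightarrow> real"
  assumes \<C>: "countable \<C>" "\<C> \<subseteq> sets borel"
    and lsc: "\<And>x y c. c < h (x, y) \<Longrightarrow> \<exists>A\<in>\<C>. \<exists>B\<in>\<C>. x \<in> A \<and> y \<in> B \<and> (\<forall>u\<in>A. \<forall>v\<in>B. c < h (u, v))"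
  shows "h \<in> borel_measurable (borel \<Otimes>\<^sub>M borel)"
proof (rule borel_measurableI_greater)
  fix c
  let ?Q = "{p \<in> \<C> \<times> \<C>. \<forall>u\<in>fst p. \<forall>v\<in>snd p. c < h (u, v)}"
  have "{z \<in> space (borel \<Otimes>\<^sub>M borel). c < h z} = (\<Union>p\<in>?Q. fst p \<times> snd p)"
    using lsc by (fastforce simp: space_pair_measure)
  also have "\<dots> \<in> sets (borel \<Otimes>\<^sub>M borel)"
  proof (rule sets.countable_UN')
    show "countable ?Q" by (rule countable_subset[of _ "\<C> \<times> \<C>"]) (use \<C>(1) in auto)
  qed (use \<C>(2) in \<open>auto intro!: pair_measureI\<close>)
  finally show "{z \<in> space (borel \<Otimes>\<^sub>M borel). c < h z} \<in> sets (borel \<Otimes>\<^sub>M borel)" .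
qed

section \<open>Iterating the kernel on measures\<close>

lemma measurable_kernel_power:
  assumes P: "P \<in> borel \<rightarrow>\<^sub>M prob_algebra borel"
  shows "kernel_power P n \<in> borel \<rightarrow>\<^sub>M prob_algebra borel"
proof (induction n)
  case (Suc n)
  then show ?case using measurable_bind_prob_space[OF Suc P] by simp
qed (use measurable_return_prob_space[of borel] in simp)

lemma bind_in_prob_algebra:
  assumes "\<mu> \<in> space (prob_algebra M)" "P \<in> M \<rightarrow>\<^sub>M prob_algebra N"
  shows "\<mu> \<bind> P \<in> space (prob_algebra N)"
  using prob_space_bind'[OF assms] sets_bind'[OF assms] by (simp add: space_prob_algebra)

lemma bind_kernel_power_0:
  assumes "\<mu> \<in> space (prob_algebra borel)"
  shows "\<mu> \<bind> kernel_power P 0 = \<mu>"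
  using bind_return''[of \<mu> borel] assms by (simp add: space_prob_algebra)

lemma bind_kernel_power_Suc:
  assumes \<mu>: "\<mu> \<in> space (prob_algebra borel)" and P: "P \<in> borel \<rightarrow>\<^sub>M prob_algebra borel"
  shows "\<mu> \<bind> kernel_power P (Suc n) = (\<mu> \<bind> kernel_power P n) \<bind> P"
proof -
  have "kernel_power P n \<in> \<mu> \<rightarrow>\<^sub>M subprob_algebra borel"
    using measurable_prob_algebraD[OF measurable_kernel_power[OF P]] \<mu>
    by (simp add: space_prob_algebra cong: measurable_cong_sets)
  from bind_assoc[OF this measurable_prob_algebraD[OF P]] show ?thesis by simp
qed

text \<open>For nonzero \<open>c\<close>, divide. For c = 0 a member of \<open>I\<close> gives x =
  0; over an empty \<open>I\<close> the right-hand side would be 0 * \<top> = 0.\<close>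

lemma ennreal_le_mult_INF:
  fixes f :: "'a \<Rightarrow> ennreal"
  assumes le: "\<And>i. i \<in> I \<Longrightarrow> x \<le> c * f i" and "I \<noteq> {}" "c < \<top>"
  shows "x \<le> c * (INF i\<in>I. f i)"
proof (cases "c = 0")
  case True
  then show ?thesis using assms by auto
next
  case False
  then have "x / c \<le> (INF i\<in>I. f i)"
    by (intro INF_greatest divide_le_posI_ennreal le) (auto simp: zero_less_iff_neq_zero)
  then have "c * (x / c) \<le> c * (INF i\<in>I. f i)" by (rule mult_left_mono) simp
  moreover have "x * c / c = x" using False \<open>c < \<top>\<close> by (intro mult_divide_eq_ennreal) auto
  ultimately show ?thesis by (simp add: ennreal_times_divide mult.commute)
qed

text \<open>The one-step bound is integrated against every coupling at time \<open>n\<close>, and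
  only then is the infimum taken.\<close>

lemma wasserstein_bind_contraction:
  fixes h :: "'a::polish_space \<times> 'a \<Rightarrow> real" and P :: "'a \<Rightarrow> 'a measure"
  assumes \<mu>: "\<mu> \<in> space (prob_algebra borel)" and \<nu>: "\<nu> \<in> space (prob_algebra borel)"
    and P: "P \<in> borel \<rightarrow>\<^sub>M prob_algebra borel"
    and \<C>: "countable \<C>" "\<C> \<subseteq> sets borel"
    and lsc: "\<And>x y c. c < h (x, y) \<Longrightarrow> \<exists>A\<in>\<C>. \<exists>B\<in>\<C>. x \<in> A \<and> y \<in> B \<and> (\<forall>u\<in>A. \<forall>v\<in>B. c < h (u, v))"
    and le: "\<And>x y. wasserstein h (P x) (P y) \<le> \<rho> * ennreal (h (x, y))" and \<rho>: "\<rho> < \<top>"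
  shows "wasserstein h (\<mu> \<bind> kernel_power P n) (\<nu> \<bind> kernel_power P n) \<le> \<rho> ^ n * wasserstein h \<mu> \<nu>"
proof (induction n)
  case 0
  show ?case using \<mu> \<nu> by (simp only: bind_kernel_power_0) simp
next
  case (Suc n)
  have [measurable]: "h \<in> borel_measurable (borel \<Otimes>\<^sub>M borel)"
    by (rule borel_measurable_rectangles[OF \<C> lsc])
  let ?\<mu> = "\<mu> \<bind> kernel_power P n" and ?\<nu> = "\<nu> \<bind> kernel_power P n"
  have \<mu>n: "?\<mu> \<in> space (prob_algebra borel)" and \<nu>n: "?\<nu> \<in> space (prob_algebra borel)"
    using \<mu> \<nu> measurable_kernel_power[OF P] by (auto intro: bind_in_prob_algebra)
  have "wasserstein h (?\<mu> \<bind> P) (?\<nu> \<bind> P) \<le> \<rho> * (\<integral>\<^sup>+ z. ennreal (h z) \<partial>\<upsilon>)"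
    if \<upsilon>: "\<upsilon> \<in> couplings ?\<mu> ?\<nu>" for \<upsilon>
  proof -
    note [measurable_cong] = couplingsD(2)[OF \<upsilon>]
    have "wasserstein h (?\<mu> \<bind> P) (?\<nu> \<bind> P) \<le> (\<integral>\<^sup>+ z. \<rho> * ennreal (h z) \<partial>\<upsilon>)"
      by (rule wasserstein_bind_le[OF \<mu>n \<nu>n P \<C> lsc _ le \<upsilon>]) auto
    then show ?thesis by (simp add: nn_integral_cmult)
  qed
  then have "wasserstein h (?\<mu> \<bind> P) (?\<nu> \<bind> P) \<le> \<rho> * wasserstein h ?\<mu> ?\<nu>"
    unfolding wasserstein_def[of h ?\<mu> ?\<nu>]
    by (rule ennreal_le_mult_INF) (use pair_measure_in_couplings[OF \<mu>n \<nu>n] \<rho> in auto)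
  also have "\<dots> \<le> \<rho> * (\<rho> ^ n * wasserstein h \<mu> \<nu>)"
    by (intro mult_left_mono Suc.IH) simp
  finally show ?case using \<mu> \<nu> P by (simp add: bind_kernel_power_Suc mult.assoc del: kernel_power.simps)
qed

text \<open>The cost is increasing in \<psi>, V x and V y. Near (x, y) a basic rectangle keeps
  \<psi> from dropping by \<open>e\<close>, and rational superlevel sets do the same for
  \<open>V\<close>; continuity of the powers absorbs the loss.\<close>

lemma geometric_mean_rectangle:
  fixes \<psi> :: "'a::topological_space \<times> 'a \<Rightarrow> real" and V :: "'a \<Rightarrow> real"
  assumes \<psi>: "\<And>x y. 0 \<le> \<psi> (x, y)" "lower_semicontinuous \<psi>"
    and V: "\<And>x. 0 \<le> V x" and a: "0 \<le> a" and r: "0 < r" "r < 1"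
    and \<B>: "topological_basis \<B>"
    and c: "c < \<psi> (x, y) powr r * (a * (V x + V y + 1)) powr (1 - r)"
  shows "\<exists>A\<in>(\<lambda>(B, q). B \<inter> {x. of_rat q < V x}) ` (\<B> \<times> UNIV).
    \<exists>B\<in>(\<lambda>(B, q). B \<inter> {x. of_rat q < V x}) ` (\<B> \<times> UNIV). x \<in> A \<and> y \<in> B \<and>
      (\<forall>u\<in>A. \<forall>v\<in>B. c < \<psi> (u, v) powr r * (a * (V u + V v + 1)) powr (1 - r))"
proof -
  \<comment> \<open>The cost after all three quantities drop by \<open>e\<close>; the factor 2
    counts the two values of \<open>V\<close>. Clipping at 0 keeps the bases of the powers
    nonnegative.\<close>
  define G where "G e = max 0 (\<psi> (x, y) - e) powr r * (a * max 0 (V x + V y + 1 - 2 * e)) powr (1 - r)"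
    for e :: real
  have "(G \<longlongrightarrow> max 0 (\<psi> (x, y) - 0) powr r * (a * max 0 (V x + V y + 1 - 2 * 0)) powr (1 - r)) (at_right 0)"
    unfolding G_def using a r
    by (intro tendsto_intros tendsto_powr' disjI2 conjI always_eventually) auto
  then have "(G \<longlongrightarrow> \<psi> (x, y) powr r * (a * (V x + V y + 1)) powr (1 - r)) (at_right 0)"
    using \<psi>(1)[of x y] V[of x] V[of y] by (simp add: max_def)
  from order_tendstoD(1)[OF this c] have "\<forall>\<^sub>F e in at_right 0. c < G e \<and> 0 < e"
    using eventually_at_right_less[of 0] by eventually_elim simp
  then obtain e where e: "c < G e" "0 < e"
    using eventually_happens'[OF trivial_limit_at_right_real] by blast
  obtain A B where AB: "A \<in> \<B>" "B \<in> \<B>" "x \<in> A" "y \<in> B"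
    and \<psi>_gt: "\<And>u v. u \<in> A \<Longrightarrow> v \<in> B \<Longrightarrow> \<psi> (x, y) - e < \<psi> (u, v)"
    using lower_semicontinuous_rectangle[OF \<psi>(2) \<B>, of "\<psi> (x, y) - e" x y] e by auto
  obtain p q where p: "V x - e < of_rat p" "of_rat p < V x" and q: "V y - e < of_rat q" "of_rat q < V y"
    using of_rat_dense[of "V x - e" "V x"] of_rat_dense[of "V y - e" "V y"] e by auto
  have "c < \<psi> (u, v) powr r * (a * (V u + V v + 1)) powr (1 - r)"
    if "u \<in> A" "of_rat p < V u" "v \<in> B" "of_rat q < V v" for u v
  proof -
    have "G e \<le> \<psi> (u, v) powr r * (a * (V u + V v + 1)) powr (1 - r)"
      unfolding G_def using \<psi>_gt[OF that(1,3)] \<psi>(1)[of u v] V[of u] V[of v] a r p q that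
      by (intro mult_mono powr_mono2 mult_left_mono) auto
    with e(1) show ?thesis by simp
  qed
  then show ?thesis
    using AB p(2) q(2)
    by (intro bexI[of _ "A \<inter> {x. of_rat p < V x}"] bexI[of _ "B \<inter> {x. of_rat q < V x}"]) auto
qed

text \<open>The value depends only on the marginals, so in Hoelder's inequality the coupling can be
  chosen for \<psi> alone.\<close>

lemma nn_integral_couplings_sum:
  fixes \<mu> \<nu> :: "'a::second_countable_topology measure"
  assumes \<gamma>: "\<gamma> \<in> couplings \<mu> \<nu>"
    and V: "\<And>x. 0 \<le> V x" and [measurable]: "V \<in> borel_measurable borel" and a: "0 \<le> a"
  shows "(\<integral>\<^sup>+ z. ennreal (a * (V (fst z) + V (snd z) + 1)) \<partial>\<gamma>)
    = ennreal a * ((\<integral>\<^sup>+ x. ennreal (V x) \<partial>\<mu>) + (\<integral>\<^sup>+ x. ennreal (V x) \<partial>\<nu>) + 1)"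
proof -
  note [measurable_cong] = couplingsD(2)[OF \<gamma>]
  interpret \<gamma>: prob_space \<gamma> by (rule couplingsD(1)[OF \<gamma>])
  have "(\<integral>\<^sup>+ z. ennreal (a * (V (fst z) + V (snd z) + 1)) \<partial>\<gamma>)
      = (\<integral>\<^sup>+ z. ennreal a * (ennreal (V (fst z)) + ennreal (V (snd z)) + 1) \<partial>\<gamma>)"
    using a V by (intro nn_integral_cong) (simp add: ennreal_mult ennreal_plus)
  also have "\<dots> = ennreal a * ((\<integral>\<^sup>+ z. ennreal (V (fst z)) \<partial>\<gamma>) + (\<integral>\<^sup>+ z. ennreal (V (snd z)) \<partial>\<gamma>) + 1)"
    by (simp add: nn_integral_cmult nn_integral_add \<gamma>.emeasure_space_1)
  finally show ?thesis
    by (simp add: couplings_nn_integral[OF \<gamma>, of "\<lambda>x. ennreal (V x)"])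
qed

text \<open>Hoelder's inequality under a coupling nearly optimal for \<psi>. Enlarging
  \<open>s\<close> and \<open>t\<close> by \<open>e\<close> both makes them positive and leaves room
  for an infimum that is not attained; then \<open>e\<close> tends to 0.\<close>

lemma wasserstein_geometric_mean_le:
  fixes \<psi> :: "'a::second_countable_topology \<times> 'a \<Rightarrow> real" and \<mu> \<nu> :: "'a measure"
  assumes \<psi>: "\<And>x y. 0 \<le> \<psi> (x, y)" and [measurable]: "\<psi> \<in> borel_measurable (borel \<Otimes>\<^sub>M borel)"
    and V: "\<And>x. 0 \<le> V x" and [measurable]: "V \<in> borel_measurable borel"
    and a: "0 \<le> a" and r: "0 < r" "r < 1" and st: "0 \<le> s" "0 \<le> t"
    and W: "wasserstein \<psi> \<mu> \<nu> \<le> ennreal s"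
    and t: "ennreal a * ((\<integral>\<^sup>+ x. ennreal (V x) \<partial>\<mu>) + (\<integral>\<^sup>+ x. ennreal (V x) \<partial>\<nu>) + 1) \<le> ennreal t"
  shows "wasserstein (\<lambda>z. \<psi> z powr r * (a * (V (fst z) + V (snd z) + 1)) powr (1 - r)) \<mu> \<nu>
    \<le> ennreal (s powr r * t powr (1 - r))"
proof -
  let ?u = "\<lambda>z. a * (V (fst z) + V (snd z) + 1)"
  let ?h = "\<lambda>z. \<psi> z powr r * ?u z powr (1 - r)"
  have "wasserstein ?h \<mu> \<nu> \<le> ennreal ((s + e) powr r * (t + e) powr (1 - r))" if e: "e > 0" for e
  proof -
    have "ennreal s < ennreal (s + e)" using st e by (simp add: ennreal_less_iff)
    with W have "wasserstein \<psi> \<mu> \<nu> < ennreal (s + e)" by (rule le_less_trans)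
    then obtain \<gamma> where \<gamma>: "\<gamma> \<in> couplings \<mu> \<nu>" and cost: "(\<integral>\<^sup>+ z. ennreal (\<psi> z) \<partial>\<gamma>) < ennreal (s + e)"
      unfolding wasserstein_def INF_less_iff by blast
    note [measurable_cong] = couplingsD(2)[OF \<gamma>]
    interpret \<gamma>: prob_space \<gamma> by (rule couplingsD(1)[OF \<gamma>])
    have "(\<integral>\<^sup>+ z. ennreal (?u z) \<partial>\<gamma>) \<le> ennreal t"
      using t by (simp add: nn_integral_couplings_sum[OF \<gamma>] V a)
    also have "\<dots> \<le> ennreal (t + e)" using e by (intro ennreal_leI) simp
    finally have u: "(\<integral>\<^sup>+ z. ennreal (?u z) \<partial>\<gamma>) \<le> ennreal (t + e)" .
    have "(\<integral>\<^sup>+ z. ennreal (?h z) \<partial>\<gamma>) \<le> ennreal ((s + e) powr r * (t + e) powr (1 - r))"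
    proof (rule nn_integral_powr_mult_le)
      show "0 \<le> \<psi> z" for z using \<psi>[of "fst z" "snd z"] by simp
    qed (use V a r st e cost u in \<open>auto intro!: mult_nonneg_nonneg add_nonneg_nonneg\<close>)
    with \<gamma> show ?thesis unfolding wasserstein_def by (rule INF_lower2)
  qed
  then have ev: "\<forall>\<^sub>F e in at_right 0. wasserstein ?h \<mu> \<nu> \<le> ennreal ((s + e) powr r * (t + e) powr (1 - r))"
    using eventually_at_right_less[of 0] by (auto elim: eventually_mono)
  have "((\<lambda>e. (s + e) powr r * (t + e) powr (1 - r)) \<longlongrightarrow> (s + 0) powr r * (t + 0) powr (1 - r)) (at_right 0)"
    using r st eventually_at_right_less[of "0 :: real"]
    by (intro tendsto_intros tendsto_powr' disjI2 conjI) (auto elim: eventually_mono)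
  then have "((\<lambda>e. ennreal ((s + e) powr r * (t + e) powr (1 - r))) \<longlongrightarrow> ennreal (s powr r * t powr (1 - r))) (at_right 0)"
    by (intro tendsto_ennrealI) simp
  from tendsto_lowerbound[OF this ev] show ?thesis by simp
qed

theorem theorem2p6:
  fixes \<psi> \<Gamma> \<Lambda> :: "'a::polish_space \<times> 'a \<Rightarrow> real"
    and P :: "'a \<Rightarrow> 'a measure"
    and V :: "'a \<Rightarrow> real"
    and a r :: real
  assumes psi_nonneg: "\<And>x y. 0 \<le> \<psi> (x, y)"
    and psi_lsc: "lower_semicontinuous \<psi>"
    and P_kernel: "P \<in> borel \<rightarrow>\<^sub>M prob_algebra borel"
    and V_meas: "V \<in> borel_measurable borel"
    and V_nonneg: "\<And>x. 0 \<le> V x"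
    and a_nonneg: "0 \<le> a"
    and psi_le: "\<And>x y. \<psi> (x, y) \<le> a * (V x + V y + 1)"
    and PV_finite: "\<And>x. (\<integral>\<^sup>+ z. ennreal (V z) \<partial>P x) < \<infinity>"
    and Gamma_meas: "\<Gamma> \<in> borel_measurable (borel \<Otimes>\<^sub>M borel)"
    and Gamma_nonneg: "\<And>x y. 0 \<le> \<Gamma> (x, y)"
    and contract: "\<And>x y. wasserstein \<psi> (return borel x \<bind> P) (return borel y \<bind> P)
                     \<le> ennreal (\<Gamma> (x, y)) * ennreal (\<psi> (x, y))"
    and Lambda_nonneg: "\<And>x y. 0 \<le> \<Lambda> (x, y)"
    and Lambda_ge: "\<And>x y. ennreal (\<Lambda> (x, y))
                     \<ge> ((\<integral>\<^sup>+ z. ennreal (V z) \<partial>P x) + (\<integral>\<^sup>+ z. ennreal (V z) \<partial>P y) + 1)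
                        / ennreal (V x + V y + 1)"
    and r: "0 < r" "r < 1"
    and rho_lt_1: "contraction_rate \<Gamma> \<Lambda> r < 1"
  shows "(\<forall>\<mu> \<in> space (prob_algebra borel). \<forall>\<nu> \<in> space (prob_algebra borel). \<forall>n.
            wasserstein \<psi> (\<mu> \<bind> kernel_power P n) (\<nu> \<bind> kernel_power P n)
              \<le> ennreal a * ((\<integral>\<^sup>+ x. ennreal (V x) \<partial>\<mu>) + (\<integral>\<^sup>+ x. ennreal (V x) \<partial>\<nu>) + 1)
                  * contraction_rate \<Gamma> \<Lambda> r ^ n)
       \<and> (\<forall>\<pi>. stationary P \<pi> \<longrightarrow>
            (\<forall>\<mu> \<in> space (prob_algebra borel). \<forall>n.
              wasserstein \<psi> (\<mu> \<bind> kernel_power P n) \<pi>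
                \<le> ennreal a * ((\<integral>\<^sup>+ x. ennreal (V x) \<partial>\<mu>) + (\<integral>\<^sup>+ x. ennreal (V x) \<partial>\<pi>) + 1)
                    * contraction_rate \<Gamma> \<Lambda> r ^ n))"
proof -
  let ?\<rho> = "contraction_rate \<Gamma> \<Lambda> r"
  let ?PV = "\<lambda>x. \<integral>\<^sup>+ z. ennreal (V z) \<partial>P x"
  define h where "h = (\<lambda>z. \<psi> z powr r * (a * (V (fst z) + V (snd z) + 1)) powr (1 - r))"
  obtain \<B> :: "'a set set" where \<B>: "countable \<B>" "topological_basis \<B>"
    using ex_countable_basis by blast
  define \<C> where "\<C> = (\<lambda>(B, q :: rat). B \<inter> {x. of_rat q < V x}) ` (\<B> \<times> UNIV)"
  have \<C>: "countable \<C>" "\<C> \<subseteq> sets borel"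
    using \<B>(1) topological_basis_open[OF \<B>(2)] V_meas by (auto simp: \<C>_def)
  have lsc: "\<exists>A\<in>\<C>. \<exists>B\<in>\<C>. x \<in> A \<and> y \<in> B \<and> (\<forall>u\<in>A. \<forall>v\<in>B. c < h (u, v))" if "c < h (x, y)" for x y c
    using geometric_mean_rectangle[OF psi_nonneg psi_lsc V_nonneg a_nonneg r \<B>(2)] that
    unfolding h_def \<C>_def by simp
  have psi_meas: "\<psi> \<in> borel_measurable (borel \<Otimes>\<^sub>M borel)"
  proof (rule borel_measurable_rectangles[of \<B>])
    show "\<B> \<subseteq> sets borel" using topological_basis_open[OF \<B>(2)] by auto
    show "\<exists>A\<in>\<B>. \<exists>B\<in>\<B>. x \<in> A \<and> y \<in> B \<and> (\<forall>u\<in>A. \<forall>v\<in>B. c < \<psi> (u, v))" if "c < \<psi> (x, y)" for x y c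
      by (rule lower_semicontinuous_rectangle[OF psi_lsc \<B>(2) that]) blast
  qed (rule \<B>(1))
  have step: "wasserstein h (P x) (P y) \<le> ?\<rho> * ennreal (h (x, y))" for x y
  proof -
    let ?U = "V x + V y + 1"
    have U: "?U > 0" using V_nonneg[of x] V_nonneg[of y] by simp
    have ret: "return borel x \<bind> P = P x" for x
      by (rule bind_return[OF measurable_prob_algebraD[OF P_kernel]]) simp
    have W: "wasserstein \<psi> (P x) (P y) \<le> ennreal (\<Gamma> (x, y) * \<psi> (x, y))"
      using contract[of x y] Gamma_nonneg psi_nonneg by (simp add: ret ennreal_mult)
    \<comment> \<open>Clears the denominator in the hypothesis on \<Lambda>, which is positive and
      finite.\<close>
    have "?PV x + ?PV y + 1 = ennreal ?U * ((?PV x + ?PV y + 1) / ennreal ?U)"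
      using U by (simp add: ennreal_times_divide mult.commute[of "ennreal ?U"] mult_divide_eq_ennreal)
    also have "\<dots> \<le> ennreal ?U * ennreal (\<Lambda> (x, y))"
      by (intro mult_left_mono Lambda_ge) simp
    finally have "ennreal a * (?PV x + ?PV y + 1) \<le> ennreal a * (ennreal ?U * ennreal (\<Lambda> (x, y)))"
      by (rule mult_left_mono) simp
    then have PV: "ennreal a * (?PV x + ?PV y + 1) \<le> ennreal (a * (?U * \<Lambda> (x, y)))"
      using a_nonneg U Lambda_nonneg[of x y] by (simp add: ennreal_mult)
    have "wasserstein h (P x) (P y)
        \<le> ennreal ((\<Gamma> (x, y) * \<psi> (x, y)) powr r * (a * (?U * \<Lambda> (x, y))) powr (1 - r))"
      unfolding h_def
      by (rule wasserstein_geometric_mean_le[OF psi_nonneg psi_meas V_nonneg V_meas a_nonneg r _ _ W PV])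
        (use Gamma_nonneg psi_nonneg a_nonneg U Lambda_nonneg in auto)
    \<comment> \<open>Collecting the powers of \<Gamma> and \<Lambda> leaves precisely
      \<open>h\<close>, so the one-step factor is a member of the supremum that defines the
      rate.\<close>
    also have "(\<Gamma> (x, y) * \<psi> (x, y)) powr r * (a * (?U * \<Lambda> (x, y))) powr (1 - r)
        = \<Gamma> (x, y) powr r * \<Lambda> (x, y) powr (1 - r) * h (x, y)"
      using Gamma_nonneg[of x y] psi_nonneg[of x y] a_nonneg U Lambda_nonneg[of x y]
      by (simp add: h_def powr_mult)
    also have "ennreal \<dots> = ennreal (\<Gamma> (x, y) powr r * \<Lambda> (x, y) powr (1 - r)) * ennreal (h (x, y))"
      by (intro ennreal_mult) (auto simp: h_def)
    also have "\<dots> \<le> ?\<rho> * ennreal (h (x, y))"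
      unfolding contraction_rate_def by (intro mult_right_mono SUP_upper) auto
    finally show ?thesis .
  qed
  have main: "wasserstein \<psi> (\<mu> \<bind> kernel_power P n) (\<nu> \<bind> kernel_power P n)
      \<le> ennreal a * ((\<integral>\<^sup>+ x. ennreal (V x) \<partial>\<mu>) + (\<integral>\<^sup>+ x. ennreal (V x) \<partial>\<nu>) + 1) * ?\<rho> ^ n"
    if \<mu>: "\<mu> \<in> space (prob_algebra borel)" and \<nu>: "\<nu> \<in> space (prob_algebra borel)" for \<mu> \<nu> n
  proof -
    have \<psi>_u: "\<psi> z \<le> a * (V (fst z) + V (snd z) + 1)" and \<psi>0: "0 \<le> \<psi> z" for z
      using psi_le[of "fst z" "snd z"] psi_nonneg[of "fst z" "snd z"] by auto
    have \<psi>_h: "\<psi> z \<le> h z" for z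
    proof -
      have "\<psi> z = \<psi> z powr r * \<psi> z powr (1 - r)"
        using \<psi>0[of z] by (simp flip: powr_add)
      also have "\<dots> \<le> h z"
        unfolding h_def using r \<psi>0[of z] \<psi>_u[of z] by (intro mult_left_mono powr_mono2) auto
      finally show ?thesis .
    qed
    have h_u: "h z \<le> a * (V (fst z) + V (snd z) + 1)" for z
    proof -
      let ?u = "a * (V (fst z) + V (snd z) + 1)"
      have "h z \<le> ?u powr r * ?u powr (1 - r)"
        unfolding h_def using r \<psi>0[of z] \<psi>_u[of z] by (intro mult_right_mono powr_mono2) auto
      also have "\<dots> = ?u" using \<psi>0[of z] \<psi>_u[of z] by (simp flip: powr_add)
      finally show ?thesis .
    qed
    \<comment> \<open>The cost changes only at the two ends, \<psi> \<le> h at time \<open>n\<close>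
      and h \<le> u at time 0, so the constant \<open>a\<close> enters once and not at each
      step.\<close>
    have "wasserstein \<psi> (\<mu> \<bind> kernel_power P n) (\<nu> \<bind> kernel_power P n)
        \<le> wasserstein h (\<mu> \<bind> kernel_power P n) (\<nu> \<bind> kernel_power P n)"
      unfolding wasserstein_def by (intro INF_mono' nn_integral_mono ennreal_leI \<psi>_h)
    also have "\<dots> \<le> ?\<rho> ^ n * wasserstein h \<mu> \<nu>"
      by (rule wasserstein_bind_contraction[OF \<mu> \<nu> P_kernel \<C> lsc step])
        (use rho_lt_1 in \<open>auto intro: less_trans\<close>)
    also have "\<dots> \<le> ?\<rho> ^ n * (ennreal a * ((\<integral>\<^sup>+ x. ennreal (V x) \<partial>\<mu>) + (\<integral>\<^sup>+ x. ennreal (V x) \<partial>\<nu>) + 1))"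
    proof (rule mult_left_mono)
      have \<gamma>: "\<mu> \<Otimes>\<^sub>M \<nu> \<in> couplings \<mu> \<nu>" by (rule pair_measure_in_couplings[OF \<mu> \<nu>])
      have "wasserstein h \<mu> \<nu> \<le> (\<integral>\<^sup>+ z. ennreal (h z) \<partial>(\<mu> \<Otimes>\<^sub>M \<nu>))"
        unfolding wasserstein_def by (rule INF_lower[OF \<gamma>])
      also have "\<dots> \<le> (\<integral>\<^sup>+ z. ennreal (a * (V (fst z) + V (snd z) + 1)) \<partial>(\<mu> \<Otimes>\<^sub>M \<nu>))"
        by (intro nn_integral_mono ennreal_leI h_u)
      also have "\<dots> = ennreal a * ((\<integral>\<^sup>+ x. ennreal (V x) \<partial>\<mu>) + (\<integral>\<^sup>+ x. ennreal (V x) \<partial>\<nu>) + 1)"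
        by (rule nn_integral_couplings_sum[OF \<gamma> V_nonneg V_meas a_nonneg])
      finally show "wasserstein h \<mu> \<nu> \<le> ennreal a * ((\<integral>\<^sup>+ x. ennreal (V x) \<partial>\<mu>) + (\<integral>\<^sup>+ x. ennreal (V x) \<partial>\<nu>) + 1)" .
    qed simp
    finally show ?thesis by (simp add: mult.commute)
  qed
  \<comment> \<open>The stationary bound is the general one with second initial law \<pi>, which the
    kernel powers leave fixed.\<close>
  have "\<pi> \<bind> kernel_power P n = \<pi>" if "stationary P \<pi>" for \<pi> n
  proof (induction n)
    case (Suc n)
    then show ?case using that P_kernel by (simp add: stationary_def bind_kernel_power_Suc del: kernel_power.simps)
  qed (use that bind_kernel_power_0 in \<open>auto simp: stationary_def simp del: kernel_power.simps\<close>)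
  then have "wasserstein \<psi> (\<mu> \<bind> kernel_power P n) \<pi>
      \<le> ennreal a * ((\<integral>\<^sup>+ x. ennreal (V x) \<partial>\<mu>) + (\<integral>\<^sup>+ x. ennreal (V x) \<partial>\<pi>) + 1) * ?\<rho> ^ n"
    if "stationary P \<pi>" "\<mu> \<in> space (prob_algebra borel)" for \<mu> \<pi> n
    using main[of \<mu> \<pi> n] that by (simp add: stationary_def)
  with main show ?thesis by blast
qed

end
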